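(* Suppose $v_n$ is a positive solution to the PDE $-\Delta_+v_n-n=0$ on $\mathbb R^{n+1}_+$. Define the metric $g_n^*=\frac{e^{2v_n}}{y^2}|dz|^2$ and $w_n=1-\frac{e^{v_n}}{y}$. Assume the following conditions: (1) $w_n\in\tilde H^{1,0}(\mathbb R^{n+1}_+)$. (2) The scalar curvature $R_n^*$ of $g_n^*$ is non-negative. Then $w_n\equiv0$, or equivalently, $g_n^*\equiv|dz|^2$.
   Context: $\mathbb R^{n+1}_+=\{z=(x,y):x\in\mathbb R^n,\ y>0\}$, $\mathbb R^n$ is identified with $\{y=0\}$, $g_+=y^{-2}|dz|^2$ is the hyperbolic metric and $\Delta_+$ is its Laplace–Beltrami operator (so $-\Delta_+\ge0$). $B_r^+=\{z\in\mathbb R^{n+1}_+:|z|<r\}$. $\tilde H^{1,0}(\mathbb R^{n+1}_+)$ is the set of $u\in W^{1,1}_{\mathrm{loc}}(\mathbb R^{n+1}_+)$ such that for every $r>0$: $\int_{B_r^+}(|\nabla u|^2+u^2)\,dz<\infty$, and there is a sequence $\phi_k\in C^1_c(\overline{B_r^+}\setminus\mathbb R^n)$ with $\int_{B_r^+}(|\nabla(u-\phi_k)|^2+|u-\phi_k|^2)\,dz\to0$. *)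

theory Defs
  imports "HOL-Analysis.Analysis" "HOL-Combinatorics.Permutations"
begin

section \<open>Functions of class $C^k$\<close>

text \<open>Meaningful for open \<open>S\<close>, since the derivatives are taken in the ambient space.\<close>

primrec Ck_on :: "nat \<Rightarrow> 'a::euclidean_space set \<Rightarrow> ('a \<Rightarrow> real) \<Rightarrow> bool" where
  "Ck_on 0 S f = continuous_on S f"
| "Ck_on (Suc k) S f \<longleftrightarrow>
     (\<forall>z\<in>S. f differentiable (at z)) \<and>
     (\<forall>b\<in>Basis. Ck_on k S (\<lambda>z. frechet_derivative f (at z) b))"

text \<open>$C^1_c(A)$ for a set \<open>A\<close> that need not be open: restrictions to \<open>A\<close> of functions
  that are $C^1$ near \<open>A\<close>, with compact support contained in \<open>A\<close>.  The values outside
  \<open>A\<close> are irrelevant.\<close>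

definition C1c_on :: "'a::euclidean_space set \<Rightarrow> ('a \<Rightarrow> real) \<Rightarrow> bool" where
  "C1c_on A f \<longleftrightarrow>
     (\<exists>U. open U \<and> A \<subseteq> U \<and> Ck_on 1 U f) \<and>
     (\<exists>K. compact K \<and> K \<subseteq> A \<and> (\<forall>z\<in>A - K. f z = 0))"

definition gradient :: "('a::euclidean_space \<Rightarrow> real) \<Rightarrow> 'a \<Rightarrow> 'a" where
  "gradient f z = (\<Sum>b\<in>Basis. frechet_derivative f (at z) b *\<^sub>R b)"


section \<open>Riemannian metrics in a global chart\<close>

text \<open>A metric on an open subset of a Euclidean space assigns to each point a bilinear form
  on the ambient space, which serves as every tangent space.\<close>

type_synonym 'a metric = "'a \<Rightarrow> 'a \<Rightarrow> 'a \<Rightarrow> real"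

text \<open>Raising an index: the vector that represents a linear form with respect to an
  inner product.\<close>

definition sharp :: "('a::euclidean_space \<Rightarrow> 'a \<Rightarrow> real) \<Rightarrow> ('a \<Rightarrow> real) \<Rightarrow> 'a" where
  "sharp h \<phi> = (THE X. \<forall>u. h X u = \<phi> u)"

definition metric_det :: "'a::euclidean_space metric \<Rightarrow> 'a \<Rightarrow> real" where
  "metric_det g z =
     (\<Sum>p | p permutes (Basis :: 'a set). of_int (sign p) * (\<Prod>b\<in>Basis. g z b (p b)))"

definition riem_gradient :: "'a::euclidean_space metric \<Rightarrow> ('a \<Rightarrow> real) \<Rightarrow> 'a \<Rightarrow> 'a" where
  "riem_gradient g f z = sharp (g z) (frechet_derivative f (at z))"

definition riem_divergence :: "'a::euclidean_space metric \<Rightarrow> ('a \<Rightarrow> 'a) \<Rightarrow> 'a \<Rightarrow> real" where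
  "riem_divergence g X z =
     (\<Sum>b\<in>Basis. frechet_derivative (\<lambda>p. sqrt (metric_det g p) * (X p \<bullet> b)) (at z) b)
       / sqrt (metric_det g z)"

definition laplace_beltrami :: "'a::euclidean_space metric \<Rightarrow> ('a \<Rightarrow> real) \<Rightarrow> 'a \<Rightarrow> real" where
  "laplace_beltrami g f = riem_divergence g (riem_gradient g f)"

text \<open>$\Gamma(u,v) = \nabla_u v$ for constant vector fields \<open>u\<close>, \<open>v\<close> and the
  Levi-Civita connection (Koszul formula).\<close>

definition christoffel :: "'a::euclidean_space metric \<Rightarrow> 'a \<Rightarrow> 'a \<Rightarrow> 'a \<Rightarrow> 'a" where
  "christoffel g u v z =
     sharp (g z) (\<lambda>t. (frechet_derivative (\<lambda>p. g p v t) (at z) u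
                     + frechet_derivative (\<lambda>p. g p u t) (at z) v
                     - frechet_derivative (\<lambda>p. g p u v) (at z) t) / 2)"

text \<open>Sign convention: $R(u,v)t = \nabla_u\nabla_v t - \nabla_v\nabla_u t$ on constant
  (hence commuting) fields, so that round spheres have positive Ricci curvature.\<close>

definition riem_curvature :: "'a::euclidean_space metric \<Rightarrow> 'a \<Rightarrow> 'a \<Rightarrow> 'a \<Rightarrow> 'a \<Rightarrow> 'a" where
  "riem_curvature g u v t z =
     frechet_derivative (christoffel g v t) (at z) u
     - frechet_derivative (christoffel g u t) (at z) v
     + christoffel g u (christoffel g v t z) z
     - christoffel g v (christoffel g u t z) z"

definition ricci_curvature :: "'a::euclidean_space metric \<Rightarrow> 'a \<Rightarrow> 'a \<Rightarrow> 'a \<Rightarrow> real" where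
  "ricci_curvature g v t z = (\<Sum>b\<in>Basis. riem_curvature g b v t z \<bullet> b)"

text \<open>The vector \<open>sharp (g z) (\<lambda>u. u \<bullet> b)\<close> has the coordinates $g^{bc}$, so this is
  $\sum_{b,c} g^{bc} \mathrm{Ric}_{bc}$.\<close>

definition scalar_curvature :: "'a::euclidean_space metric \<Rightarrow> 'a \<Rightarrow> real" where
  "scalar_curvature g z =
     (\<Sum>b\<in>Basis. ricci_curvature g b (sharp (g z) (\<lambda>u. u \<bullet> b)) z)"


section \<open>Sobolev functions on the half-space\<close>

text \<open>The space $\mathbb R^{n+1}$ is \<open>(real ^ 'n) \<times> real\<close> with $n$ = \<open>CARD('n)\<close> and
  points \<open>z = (x, y)\<close>; its norm is the Euclidean one.\<close>

definition half_space :: "((real ^ 'n) \<times> real) set" where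
  "half_space = {z. 0 < snd z}"

definition half_ball :: "real \<Rightarrow> ((real ^ 'n) \<times> real) set" where
  "half_ball r = {z \<in> half_space. norm z < r}"

definition locally_integrable_on :: "('a::euclidean_space \<Rightarrow> 'b::euclidean_space) \<Rightarrow> 'a set \<Rightarrow> bool"
    (infixr "locally'_integrable'_on" 46) where
  "f locally_integrable_on S \<longleftrightarrow> (\<forall>K. compact K \<and> K \<subseteq> S \<longrightarrow> f absolutely_integrable_on K)"

definition weak_gradient_on ::
    "'a::euclidean_space set \<Rightarrow> ('a \<Rightarrow> real) \<Rightarrow> ('a \<Rightarrow> 'a) \<Rightarrow> bool" where
  "weak_gradient_on S u G \<longleftrightarrow>
     (\<forall>\<phi>. C1c_on S \<phi> \<longrightarrow> (\<forall>b\<in>Basis.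
        (LINT z:S|lebesgue. u z * frechet_derivative \<phi> (at z) b)
          = - (LINT z:S|lebesgue. (G z \<bullet> b) * \<phi> z)))"

text \<open>The first three conjuncts say that \<open>u\<close> lies in $W^{1,1}_{\mathrm{loc}}$ with weak
  gradient \<open>G\<close>, which is unique almost everywhere.\<close>

definition H10_tilde :: "((real ^ 'n) \<times> real \<Rightarrow> real) set" where
  "H10_tilde = {u. \<exists>G.
     u locally_integrable_on half_space \<and> G locally_integrable_on half_space \<and>
     weak_gradient_on half_space u G \<and>
     (\<forall>r>0.
        (\<integral>\<^sup>+z\<in>half_ball r. ennreal ((norm (G z))\<^sup>2 + (u z)\<^sup>2) \<partial>lebesgue) < \<infinity> \<and>
        (\<exists>\<phi> :: nat \<Rightarrow> (real ^ 'n) \<times> real \<Rightarrow> real.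
           (\<forall>k. C1c_on (closure (half_ball r) - {z. snd z = 0}) (\<phi> k)) \<and>
           (\<lambda>k. \<integral>\<^sup>+z\<in>half_ball r.
                  ennreal ((norm (G z - gradient (\<phi> k) z))\<^sup>2 + \<bar>u z - \<phi> k z\<bar>\<^sup>2) \<partial>lebesgue)
             \<longlonglongrightarrow> 0))}"


section \<open>The metrics\<close>

definition g_plus :: "((real ^ 'n) \<times> real) metric" where
  "g_plus z a b = (a \<bullet> b) / (snd z)\<^sup>2"

definition g_star :: "((real ^ 'n) \<times> real \<Rightarrow> real) \<Rightarrow> ((real ^ 'n) \<times> real) metric" where
  "g_star v z a b = exp (2 * v z) / (snd z)\<^sup>2 * (a \<bullet> b)"

text \<open>\<open>w_fun v\<close> vanishes identically exactly for \<open>v (x, y) = ln y\<close>, which is negative for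
  \<open>y < 1\<close>; indeed \<open>v > 0\<close> would give \<open>w_fun v < 1 - 1 / y\<close>, which is not square integrable
  near the boundary.  The positivity compatible with \<open>w_fun v \<in> H10_tilde\<close> is that of the
  conformal factor \<open>exp (v z)\<close>, which is automatic.  For \<open>n = 1\<close> this alone does not force
  \<open>w_fun v = 0\<close>: the functions \<open>v (x, y) = ln y + c * y\<close> solve the equation, the metrics
  \<open>g_star v\<close> are flat, and \<open>w_fun v\<close> vanishes on the boundary.\<close>

definition w_fun :: "((real ^ 'n) \<times> real \<Rightarrow> real) \<Rightarrow> (real ^ 'n) \<times> real \<Rightarrow> real" where
  "w_fun v z = 1 - exp (v z) / snd z"

end

theory Submission
  imports Defs
begin

text \<open>Write \<open>v = ln y + f\<close>.  The equation says \<open>y \<Delta>f = (n - 1) \<partial>\<^sub>yf\<close> and non-negative scalar curvature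
  says \<open>2 \<Delta>f + (n - 1) |\<nabla>f|\<^sup>2 \<le> 0\<close>, both for the Euclidean metric.  For \<open>n \<ge> 2\<close> they give
  \<open>\<partial>\<^sub>yf \<le> 0\<close>, so \<open>w = 1 - exp f\<close> increases with \<open>y\<close>; as its trace on \<open>y = 0\<close> vanishes,
  \<open>w \<ge> 0\<close> and \<open>f \<le> 0\<close>.  The curvature condition alone makes \<open>W = 1 - exp ((n - 1) f / 2)\<close>
  subharmonic, and \<open>0 \<le> W \<le> 1\<close>.  Since \<open>W\<close> has zero trace and \<open>\<partial>\<^sub>yW \<ge> 0\<close>, its extension by zero
  is subharmonic on the whole space.  The mean value inequality on a ball of radius \<open>4 y\<close>,
  a fixed fraction of which lies in \<open>y < 0\<close>, gives \<open>sup W \<le> (1 - \<theta>) sup W\<close> with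
  \<open>\<theta> > 0\<close>, so \<open>W = 0\<close>.  For \<open>n = 1\<close>, \<open>v > 0\<close> is incompatible with the square integrability
  of \<open>w\<close> near \<open>y = 0\<close>.\<close>


section \<open>Geometry of conformally flat metrics\<close>

text \<open>The obstacle is the boundary: \<open>v\<close> and its derivatives are not assumed to
  extend to y = 0, and the zero trace is known only through L^2 approximation. It is used in a
  single form: averages of w * P^2 over the layer \<epsilon> < y < 2 \<epsilon>, for a bump P, tend
  to 0 with \<epsilon>. In Green's identity for W and P^3, cut off by a step in y / \<epsilon>, the
  layer term with \<partial>W/\<partial>y has a sign by monotonicity, and the other one contains
  only W itself, which is at most n w. So no bound on the gradient of W near y = 0 enters. The
  exponent in W is dictated by the scalar curvature: with N = n + 1 and u = exp ((n - 1) f / 2) the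
  metric is u^(4/(N-2)) |dz|^2, the normalisation in which the gradient term disappears and R >= 0
  reads \<Delta>u <= 0. P is the truncated paraboloid max(0, t - |z - a|^2). On its support |z -
  a|^2 = t - P, so \<Delta>(P^3) is again a combination of P and P^2, and the mean value inequality
  becomes a differential inequality in t, without surface integrals.\<close>

lemma sharp_conformal:
  fixes Y :: "'a::euclidean_space"
  assumes "c \<noteq> 0" and "\<And>a u. h a u = c * (a \<bullet> u)" and "\<And>u. \<phi> u = Y \<bullet> u"
  shows "sharp h \<phi> = (1 / c) *\<^sub>R Y"
  unfolding sharp_def
proof (rule the_equality)
  show "\<forall>u. h ((1 / c) *\<^sub>R Y) u = \<phi> u" using assms by simp
  fix X assume "\<forall>u. h X u = \<phi> u"
  then have "(c *\<^sub>R X) \<bullet> u = Y \<bullet> u" for u using assms by simp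
  then have "c *\<^sub>R X = Y" by (meson vector_eq_rdot)
  then show "X = (1 / c) *\<^sub>R Y" using assms(1) by auto
qed

lemma frechet_derivative_eqI:
  assumes "(f has_derivative f') (at x)" shows "frechet_derivative f (at x) = f'"
  using frechet_derivative_at[OF assms] by simp

text \<open>Since dg(w) = 2 (df w) g, the Koszul expression is \<open>exp (2 * f z)\<close> times a
  Euclidean one, and raising the index cancels the exponential. The hypotheses hold on an open set
  because \<open>frechet_derivative\<close> sees \<open>g\<close> on a neighbourhood of
  \<open>z\<close>.\<close>

lemma christoffel_conformal:
  fixes f :: "'a::euclidean_space \<Rightarrow> real"
  assumes S: "open S" "z \<in> S"
    and f: "\<And>p. p \<in> S \<Longrightarrow> (f has_derivative (\<lambda>h. X p \<bullet> h)) (at p)"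
    and g: "\<And>p a b. p \<in> S \<Longrightarrow> g p a b = exp (2 * f p) * (a \<bullet> b)"
  shows "christoffel g u v z = (X z \<bullet> u) *\<^sub>R v + (X z \<bullet> v) *\<^sub>R u - (u \<bullet> v) *\<^sub>R X z"
proof -
  have D: "frechet_derivative (\<lambda>p. g p a b) (at z) w = 2 * exp (2 * f z) * (X z \<bullet> w) * (a \<bullet> b)" for a b w
  proof -
    have "((\<lambda>p. exp (2 * f p) * (a \<bullet> b)) has_derivative
        (\<lambda>w. 2 * exp (2 * f z) * (X z \<bullet> w) * (a \<bullet> b))) (at z)"
      using f[OF S(2)] by (auto intro!: derivative_eq_intros)
    then have "((\<lambda>p. g p a b) has_derivative
        (\<lambda>w. 2 * exp (2 * f z) * (X z \<bullet> w) * (a \<bullet> b))) (at z)"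
      by (rule has_derivative_transform_within_open[OF _ S]) (simp add: g)
    then show ?thesis by (simp add: frechet_derivative_eqI)
  qed
  show ?thesis
    unfolding christoffel_def
    by (subst sharp_conformal[where c="exp (2 * f z)" and
          Y="exp (2 * f z) *\<^sub>R ((X z \<bullet> u) *\<^sub>R v + (X z \<bullet> v) *\<^sub>R u - (u \<bullet> v) *\<^sub>R X z)"])
       (auto simp: g S D field_simps inner_simps)
qed

text \<open>\<open>X\<close> is the Euclidean gradient of \<open>f\<close> and the trace of
  \<open>H\<close> its Laplacian, so this is the classical formula for a conformal change of a flat
  metric.\<close>

lemma scalar_curvature_conformal:
  fixes f :: "'a::euclidean_space \<Rightarrow> real"
  assumes S: "open S" "z \<in> S"
    and f: "\<And>p. p \<in> S \<Longrightarrow> (f has_derivative (\<lambda>h. X p \<bullet> h)) (at p)"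
    and X: "(X has_derivative H) (at z)"
    and g: "\<And>p a b. p \<in> S \<Longrightarrow> g p a b = exp (2 * f p) * (a \<bullet> b)"
  shows "scalar_curvature g z = - exp (- 2 * f z) * (real DIM('a) - 1) *
           (2 * (\<Sum>b\<in>Basis. H b \<bullet> b) + (real DIM('a) - 2) * (X z \<bullet> X z))"
proof -
  let ?N = "real DIM('a)"
  have ch: "christoffel g u v p = (X p \<bullet> u) *\<^sub>R v + (X p \<bullet> v) *\<^sub>R u - (u \<bullet> v) *\<^sub>R X p"
    if "p \<in> S" for p u v
    using christoffel_conformal[OF S(1) that] f g by blast
  have Dch: "frechet_derivative (christoffel g v t) (at z) u
      = (H u \<bullet> v) *\<^sub>R t + (H u \<bullet> t) *\<^sub>R v - (v \<bullet> t) *\<^sub>R H u" for u v t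
  proof -
    have "((\<lambda>p. (X p \<bullet> v) *\<^sub>R t + (X p \<bullet> t) *\<^sub>R v - (v \<bullet> t) *\<^sub>R X p) has_derivative
        (\<lambda>u. (H u \<bullet> v) *\<^sub>R t + (H u \<bullet> t) *\<^sub>R v - (v \<bullet> t) *\<^sub>R H u)) (at z)"
      using X by (auto intro!: derivative_eq_intros)
    then have "(christoffel g v t has_derivative
        (\<lambda>u. (H u \<bullet> v) *\<^sub>R t + (H u \<bullet> t) *\<^sub>R v - (v \<bullet> t) *\<^sub>R H u)) (at z)"
      by (rule has_derivative_transform_within_open[OF _ S]) (simp add: ch)
    then show ?thesis by (simp add: frechet_derivative_eqI)
  qed
  let ?e = "exp (- 2 * f z)"
  have sh: "sharp (g z) (\<lambda>u. u \<bullet> b) = ?e *\<^sub>R b" for b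
    by (subst sharp_conformal[where c="exp (2 * f z)" and Y=b])
       (auto simp: g S inner_commute exp_minus divide_inverse)
  \<comment> \<open>The two \<open>if\<close> terms are corrections that make the right-hand side
    vanish for \<open>u = c\<close>, where the curvature is 0 by antisymmetry. With them both sums
    may run over the whole basis, and counting basis vectors produces the factors N - 1 and N -
    2.\<close>
  have summand: "riem_curvature g u c (?e *\<^sub>R c) z \<bullet> u =
      ?e * ((if u = c then 2 * (H u \<bullet> c) else 0) - (H u \<bullet> u) - (H c \<bullet> c)
        + (X z \<bullet> c)\<^sup>2 + (X z \<bullet> u)\<^sup>2 - (X z \<bullet> X z)
        + (if u = c then (X z \<bullet> X z) - 2 * (X z \<bullet> c)\<^sup>2 else 0))"
    if "u \<in> Basis" "c \<in> Basis" for u c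
  proof (cases "u = c")
    case True
    have "c \<bullet> c = 1" using that by simp
    then show ?thesis unfolding riem_curvature_def Dch ch[OF S(2)] True
      by (simp add: inner_simps inner_commute[of c "X z"] inner_commute[of c "H c"] algebra_simps power2_eq_square)
  next
    case False
    have "c \<bullet> c = 1" "u \<bullet> u = 1" "c \<bullet> u = 0" "u \<bullet> c = 0" using that False by (auto simp: inner_Basis)
    then show ?thesis unfolding riem_curvature_def Dch ch[OF S(2)] using False
      by (simp add: inner_simps inner_commute[of c "X z"] inner_commute[of u "X z"]
          inner_commute[of c "H c"] inner_commute[of c "H u"] algebra_simps power2_eq_square)
  qed
  have X2: "(\<Sum>b\<in>Basis. (X z \<bullet> b)\<^sup>2) = X z \<bullet> X z"
    by (subst euclidean_inner) (simp add: power2_eq_square)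
  have "scalar_curvature g z = (\<Sum>c\<in>Basis. \<Sum>u\<in>Basis. riem_curvature g u c (?e *\<^sub>R c) z \<bullet> u)"
    unfolding scalar_curvature_def ricci_curvature_def sh ..
  also have "\<dots> = ?e * (\<Sum>c\<in>Basis. \<Sum>u\<in>Basis. (if u = c then 2 * (H u \<bullet> c) else 0) - (H u \<bullet> u) - (H c \<bullet> c)
        + (X z \<bullet> c)\<^sup>2 + (X z \<bullet> u)\<^sup>2 - (X z \<bullet> X z)
        + (if u = c then (X z \<bullet> X z) - 2 * (X z \<bullet> c)\<^sup>2 else 0))"
    unfolding sum_distrib_left by (intro sum.cong refl summand)
  also have "\<dots> = - ?e * (?N - 1) *
           (2 * (\<Sum>b\<in>Basis. H b \<bullet> b) + (?N - 2) * (X z \<bullet> X z))"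
    by (simp add: sum.distrib sum_subtractf X2 sum_distrib_left[symmetric] algebra_simps)
  finally show ?thesis .
qed

text \<open>Only the identity survives in the Leibniz sum: any other permutation sends some basis
  vector to an orthogonal one.\<close>

lemma metric_det_conformal:
  fixes z :: "'a::euclidean_space"
  assumes "\<And>a b. g z a b = c * (a \<bullet> b)"
  shows "metric_det g z = c ^ DIM('a)"
proof -
  let ?t = "\<lambda>p. of_int (sign p) * (\<Prod>b\<in>(Basis :: 'a set). g z b (p b))"
  have 0: "?t p = 0" if p: "p permutes (Basis :: 'a set)" "p \<noteq> id" for p
  proof -
    obtain b where b: "p b \<noteq> b" using p(2) by (metis eq_id_iff)
    then have bB: "b \<in> Basis" using p(1) by (meson permutes_not_in)
    then have "p b \<in> Basis" using p(1) by (meson permutes_in_image)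
    then have "g z b (p b) = 0" using b bB by (auto simp: assms inner_Basis)
    then have "(\<Prod>b\<in>(Basis :: 'a set). g z b (p b)) = 0" using bB by (meson finite_Basis prod_zero)
    then show ?thesis by simp
  qed
  have "metric_det g z = (\<Sum>p\<in>{id}. ?t p)"
    unfolding metric_det_def
  proof (rule sum.mono_neutral_right)
    show "\<forall>p\<in>{p. p permutes Basis} - {id}. ?t p = 0" using 0 by blast
  qed (simp_all add: finite_permutations permutes_id)
  also have "\<dots> = c ^ DIM('a)" by (simp add: assms inner_Basis)
  finally show ?thesis .
qed

text \<open>With N = n + 1 the volume density is y^(-N) and the Riemannian gradient is y^2 X, so the
  operator is y^N div (y^(2-N) X). The derivative of y^(2-N) supplies the factor 2 - N = -(n - 1) of
  the vertical term.\<close>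

lemma laplace_beltrami_g_plus:
  fixes v :: "(real ^ 'n) \<times> real \<Rightarrow> real"
  assumes z: "z \<in> half_space"
    and v: "\<And>p. p \<in> half_space \<Longrightarrow> (v has_derivative (\<lambda>h. X p \<bullet> h)) (at p)"
    and X: "(X has_derivative H) (at z)"
  shows "laplace_beltrami g_plus v z =
    (snd z)\<^sup>2 * (\<Sum>b\<in>Basis. H b \<bullet> b) - (real CARD('n) - 1) * snd z * (X z \<bullet> (0, 1))"
proof -
  let ?N = "DIM((real ^ 'n) \<times> real)"
  have N: "real ?N = real CARD('n) + 1" by simp
  have S: "open (half_space :: ((real ^ 'n) \<times> real) set)"
    unfolding half_space_def by (intro open_Collect_less continuous_intros)
  have pos: "snd p > 0" if "p \<in> half_space" for p :: "(real ^ 'n) \<times> real"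
    using that by (simp add: half_space_def)
  have det: "sqrt (metric_det g_plus p) = (1 / snd p) ^ ?N" if "p \<in> half_space" for p :: "(real ^ 'n) \<times> real"
  proof -
    have "metric_det g_plus p = (1 / (snd p)\<^sup>2) ^ ?N"
      by (rule metric_det_conformal) (simp add: g_plus_def)
    then show ?thesis using pos[OF that]
      by (simp add: real_sqrt_power real_sqrt_divide del: DIM_prod DIM_cart)
  qed
  have grad: "riem_gradient g_plus v p = (snd p)\<^sup>2 *\<^sub>R X p" if "p \<in> half_space" for p
    unfolding riem_gradient_def frechet_derivative_eqI[OF v[OF that]]
    by (subst sharp_conformal[where c="1 / (snd p)\<^sup>2" and Y="X p"])
       (use pos[OF that] in \<open>auto simp: g_plus_def\<close>)
  let ?y = "snd z"
  have y: "?y > 0" using pos z by blast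
  have D: "frechet_derivative (\<lambda>p. sqrt (metric_det g_plus p) * (riem_gradient g_plus v p \<bullet> b)) (at z) b
      = (1 / ?y) ^ ?N * (?y\<^sup>2 * (H b \<bullet> b) + (2 - real ?N) * ?y * snd b * (X z \<bullet> b))" for b
  proof -
    obtain m where m: "?N = Suc m" by (metis DIM_positive gr0_implies_Suc)
    have 1: "((\<lambda>p. (1 / snd p) ^ Suc m) has_derivative
        (\<lambda>h. - real (Suc m) * (1 / ?y) ^ Suc m * snd h / ?y)) (at z)"
    proof -
      have "((\<lambda>p. 1 / snd p) has_derivative (\<lambda>h. - snd h / (?y * ?y))) (at z)"
        using y by (auto intro!: derivative_eq_intros)
      from has_derivative_power[OF this, of "Suc m"] show ?thesis
        by (rule has_derivative_eq_rhs) (use y in \<open>simp add: fun_eq_iff field_simps\<close>)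
    qed
    have "((\<lambda>p. (1 / snd p) ^ Suc m * ((snd p)\<^sup>2 * (X p \<bullet> b))) has_derivative
      (\<lambda>h. (1 / ?y) ^ Suc m * (?y\<^sup>2 * (H h \<bullet> b) + 2 * ?y * snd h * (X z \<bullet> b)) +
        - real (Suc m) * (1 / ?y) ^ Suc m * snd h / ?y * (?y\<^sup>2 * (X z \<bullet> b)))) (at z)"
      by (rule has_derivative_mult[OF 1]) (use X in \<open>auto intro!: derivative_eq_intros\<close>)
    moreover have "(1 / ?y) ^ Suc m * (?y\<^sup>2 * (H h \<bullet> b) + 2 * ?y * snd h * (X z \<bullet> b)) +
        - real (Suc m) * (1 / ?y) ^ Suc m * snd h / ?y * (?y\<^sup>2 * (X z \<bullet> b))
      = (1 / ?y) ^ Suc m * (?y\<^sup>2 * (H h \<bullet> b) + (2 - real (Suc m)) * ?y * snd h * (X z \<bullet> b))" for h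
    proof -
      have "- real (Suc m) * E * snd h / ?y * (?y\<^sup>2 * Q) = - real (Suc m) * E * snd h * ?y * Q" for E Q
        using y by (simp add: power2_eq_square)
      moreover have "E * (?y\<^sup>2 * A + 2 * ?y * s * Q) + - k * E * s * ?y * Q =
          E * (?y\<^sup>2 * A + (2 - k) * ?y * s * Q)" for A E Q k s :: real
        by algebra
      ultimately show ?thesis by (simp only:)
    qed
    ultimately have "((\<lambda>p. (1 / snd p) ^ ?N * ((snd p)\<^sup>2 * (X p \<bullet> b))) has_derivative
      (\<lambda>h. (1 / ?y) ^ ?N * (?y\<^sup>2 * (H h \<bullet> b) + (2 - real ?N) * ?y * snd h * (X z \<bullet> b)))) (at z)"
      unfolding m by (simp only:)
    then have "((\<lambda>p. sqrt (metric_det g_plus p) * (riem_gradient g_plus v p \<bullet> b)) has_derivative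
      (\<lambda>h. (1 / ?y) ^ ?N * (?y\<^sup>2 * (H h \<bullet> b) + (2 - real ?N) * ?y * snd h * (X z \<bullet> b)))) (at z)"
      by (rule has_derivative_transform_within_open[OF _ S z]) (simp add: det grad del: DIM_prod DIM_cart)
    then show ?thesis by (simp add: frechet_derivative_eqI)
  qed
  have sndsum: "(\<Sum>b\<in>Basis. snd b * (X z \<bullet> b)) = X z \<bullet> (0, 1)"
    by (subst (2) euclidean_inner) (auto simp: inner_prod_def intro!: sum.cong)
  have "laplace_beltrami g_plus v z =
      (\<Sum>b\<in>Basis. ?y\<^sup>2 * (H b \<bullet> b) + (2 - real ?N) * ?y * (snd b * (X z \<bullet> b)))"
    unfolding laplace_beltrami_def riem_divergence_def D det[OF z] sum_distrib_left[symmetric]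
    using y by (simp add: mult.assoc)
  also have "\<dots> = ?y\<^sup>2 * (\<Sum>b\<in>Basis. H b \<bullet> b) + (2 - real ?N) * ?y * (X z \<bullet> (0, 1))"
    by (simp only: sum.distrib sum_distrib_left[symmetric] sndsum)
  finally show ?thesis unfolding N by (simp add: algebra_simps)
qed


section \<open>Integrals of derivatives\<close>

text \<open>The exponent is at least 2, so at the kink the difference quotient is bounded by
  \<open>\<bar>h\<bar> ^ Suc k\<close> and tends to 0.\<close>

lemma has_real_derivative_pos_part_power:
  "((\<lambda>x::real. (max 0 x) ^ Suc (Suc k)) has_real_derivative
     real (Suc (Suc k)) * (max 0 x) ^ Suc k) (at x)"
proof -
  consider "x < 0" | "x > 0" | "x = 0" by linarith
  then show ?thesis
  proof cases
    case 1
    have "((\<lambda>x::real. 0) has_real_derivative 0) (at x)" by simp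
    then have "((\<lambda>x::real. (max 0 x) ^ Suc (Suc k)) has_real_derivative 0) (at x)"
      by (rule has_field_derivative_transform_within_open[where S="{..<0}"]) (use 1 in auto)
    then show ?thesis using 1 by simp
  next
    case 2
    have "((\<lambda>x::real. x ^ Suc (Suc k)) has_real_derivative real (Suc (Suc k)) * x ^ Suc k) (at x)"
      using DERIV_pow[of "Suc (Suc k)" x UNIV] by simp
    then have "((\<lambda>x::real. (max 0 x) ^ Suc (Suc k)) has_real_derivative
        real (Suc (Suc k)) * x ^ Suc k) (at x)"
      by (rule has_field_derivative_transform_within_open[where S="{0<..}"]) (use 2 in auto)
    then show ?thesis using 2 by (simp only: max_absorb2 less_imp_le)
  next
    case 3
    have "((\<lambda>h::real. (max 0 h) ^ Suc (Suc k) / h) \<longlongrightarrow> 0) (at 0)"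
    proof (rule Lim_null_comparison[where g="\<lambda>h. \<bar>h\<bar> ^ Suc k"])
      have "norm ((max 0 h) ^ Suc (Suc k) / h) \<le> \<bar>h\<bar> ^ Suc k" for h :: real
        by (cases h "0::real" rule: linorder_cases) (auto simp: max_absorb1 mult_nonpos_nonneg)
      then show "\<forall>\<^sub>F h in at 0. norm ((max 0 h) ^ Suc (Suc k) / h) \<le> \<bar>h :: real\<bar> ^ Suc k"
        by simp
      have "((\<lambda>h. \<bar>h::real\<bar> ^ Suc k) \<longlongrightarrow> \<bar>0\<bar> ^ Suc k) (at 0)"
        by (intro tendsto_intros)
      then show "((\<lambda>h. \<bar>h::real\<bar> ^ Suc k) \<longlongrightarrow> 0) (at 0)" by simp
    qed
    then show ?thesis using 3 by (simp add: DERIV_def)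
  qed
qed

lemma integrable_lebesgue_bounded_support:
  fixes f :: "'a::euclidean_space \<Rightarrow> real"
  assumes "f \<in> borel_measurable lebesgue"
    and "\<And>z. \<bar>f z\<bar> \<le> C" and "\<And>z. z \<notin> cball a r \<Longrightarrow> f z = 0"
  shows "integrable lebesgue f"
proof (rule Bochner_Integration.integrable_bound)
  show "integrable lebesgue (\<lambda>z. indicator (cball a r) z * C)"
    by (intro integrable_mult_left integrable_real_indicator)
       (use emeasure_bounded_finite[OF bounded_cball[of a r]] in \<open>auto simp: top.not_eq_extremum\<close>)
  show "AE z in lebesgue. norm (f z) \<le> norm (indicator (cball a r) z * C)"
    using assms(2,3) by (auto simp: indicator_def intro!: AE_I2 order_trans[OF assms(2)])
qed fact

lemma borel_measurable_lebesgue_continuous: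
  fixes f :: "'a::euclidean_space \<Rightarrow> real"
  assumes "continuous_on UNIV f"
  shows "f \<in> borel_measurable lebesgue"
  using borel_measurable_continuous_onI[OF assms] by (simp add: measurable_completion)

lemma continuous_bounded_on_cball:
  fixes f :: "'a::euclidean_space \<Rightarrow> real"
  assumes "continuous_on UNIV f"
  obtains C where "\<And>z. z \<in> cball a r \<Longrightarrow> \<bar>f z\<bar> \<le> C"
proof -
  have "compact (f ` cball a r)"
    by (intro compact_continuous_image continuous_on_subset[OF assms]) auto
  then have "bounded (f ` cball a r)" by (rule compact_imp_bounded)
  then obtain C where "\<forall>x\<in>f ` cball a r. norm x \<le> C" unfolding bounded_iff by blast
  then show thesis using that[of C] by simp
qed

text \<open>Difference quotients in direction \<open>b\<close> have integral 0 by translation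
  invariance, and by the mean value theorem they converge boundedly to the derivative. All later
  divergence identities apply this to an explicit compactly supported function, one basis direction
  at a time.\<close>

lemma
  fixes g :: "'a::euclidean_space \<Rightarrow> real"
  assumes der: "\<And>z. (g has_derivative D z) (at z)"
    and cont: "continuous_on UNIV (\<lambda>z. D z b)"
    and supp: "\<And>z. r \<le> norm z \<Longrightarrow> g z = 0"
  shows integrable_directional_derivative: "integrable lebesgue (\<lambda>z. D z b)" (is ?integrable)
    and integral_directional_derivative_eq_0: "integral\<^sup>L lebesgue (\<lambda>z. D z b) = 0" (is ?zero)
proof -
  have gcont: "continuous_on UNIV g"
    by (intro continuous_at_imp_continuous_on ballI has_derivative_continuous[OF der])
  have line: "((\<lambda>s. g (z + s *\<^sub>R b)) has_real_derivative D (z + s *\<^sub>R b) b) (at s)" for z s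
  proof -
    have "((\<lambda>s. g (z + s *\<^sub>R b)) has_derivative (\<lambda>h. D (z + s *\<^sub>R b) (h *\<^sub>R b))) (at s)"
      by (rule has_derivative_compose[OF _ der, where f="\<lambda>s. z + s *\<^sub>R b"])
         (auto intro!: derivative_eq_intros)
    moreover have "D (z + s *\<^sub>R b) (h *\<^sub>R b) = D (z + s *\<^sub>R b) b * h" for h
      using has_derivative_linear[OF der] by (simp add: linear_scale)
    ultimately show ?thesis by (simp add: has_field_derivative_def)
  qed
  \<comment> \<open>Differentiation needs an open set, hence the strict inequality; on the sphere
    itself the bound comes from compactness of the closed ball.\<close>
  have D0: "D z b = 0" if "r < norm z" for z
  proof -
    have "((\<lambda>_. 0) has_derivative D z) (at z)"
    proof (rule has_derivative_transform_within_open[OF der])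
      show "open {z::'a. r < norm z}" by (intro open_Collect_less continuous_intros)
    qed (use that supp in auto)
    then have "D z = (\<lambda>_. 0)" using has_derivative_unique has_derivative_const by blast
    then show ?thesis by simp
  qed
  obtain C0 where C0: "\<And>z. z \<in> cball 0 r \<Longrightarrow> \<bar>D z b\<bar> \<le> C0"
    using continuous_bounded_on_cball[OF cont] by blast
  define C where "C = max 0 C0"
  have C: "\<bar>D z b\<bar> \<le> C" for z
    using C0[of z] D0[of z] by (cases "norm z \<le> r") (auto simp: C_def)
  \<comment> \<open>Steps of length at most 1 keep every difference quotient supported in the ball
    of radius \<open>r + norm b\<close>, which gives one dominating function.\<close>
  define s where "s k = 1 / real (Suc k)" for k
  have s: "0 < s k" "s k \<le> 1" for k by (auto simp: s_def)
  have s0: "s \<longlonglongrightarrow> 0" unfolding s_def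
    using LIMSEQ_inverse_real_of_nat by (simp add: field_simps)
  define X where "X k z = (g (z + s k *\<^sub>R b) - g z) / s k" for k z
  have gint: "integrable lborel g"
  proof -
    obtain c where c: "\<And>z. z \<in> cball 0 r \<Longrightarrow> \<bar>g z\<bar> \<le> c"
      using continuous_bounded_on_cball[OF gcont] by blast
    have "\<bar>g z\<bar> \<le> max 0 c" for z
      using c[of z] supp[of z] by (cases "r \<le> norm z") auto
    then have "integrable lebesgue g"
      by (rule integrable_lebesgue_bounded_support[OF borel_measurable_lebesgue_continuous[OF gcont],
            where r=r and a=0]) (use supp in auto)
    then show ?thesis
      using borel_measurable_continuous_onI[OF gcont] by (simp add: integrable_completion)
  qed
  have shift: "integrable lborel (\<lambda>z. g (z + a))"
    "integral\<^sup>L lborel (\<lambda>z. g (z + a)) = integral\<^sup>L lborel g" for a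
  proof -
    have m: "g \<in> borel_measurable borel" using borel_measurable_continuous_onI[OF gcont] .
    have "integrable (distr lborel borel ((+) a)) g" using gint by (simp add: lborel_distr_plus)
    then show "integrable lborel (\<lambda>z. g (z + a))"
      using m by (subst (asm) integrable_distr_eq) (auto simp: add.commute)
    have "integral\<^sup>L lborel g = integral\<^sup>L (distr lborel borel ((+) a)) g"
      by (simp add: lborel_distr_plus)
    also have "\<dots> = integral\<^sup>L lborel (\<lambda>z. g (z + a))"
      using m by (subst integral_distr) (auto simp: add.commute)
    finally show "integral\<^sup>L lborel (\<lambda>z. g (z + a)) = integral\<^sup>L lborel g" by simp
  qed
  have X0: "integral\<^sup>L lborel (X k) = 0" for k
    unfolding X_def using shift[of "s k *\<^sub>R b"] gint by simp
  have XC: "\<bar>X k z\<bar> \<le> C" for k z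
  proof -
    obtain \<xi> where "g (z + s k *\<^sub>R b) - g (z + 0 *\<^sub>R b) = (s k - 0) * D (z + \<xi> *\<^sub>R b) b"
      using MVT2[of 0 "s k" "\<lambda>s. g (z + s *\<^sub>R b)" "\<lambda>s. D (z + s *\<^sub>R b) b"] line s by blast
    then have "X k z = D (z + \<xi> *\<^sub>R b) b" using s(1)[of k] by (simp add: X_def)
    then show ?thesis using C by simp
  qed
  have Xsupp: "X k z = 0" if "z \<notin> cball 0 (r + norm b)" for k z
  proof -
    have "norm (s k *\<^sub>R b) \<le> norm b" using s[of k] by (simp add: mult_left_le_one_le)
    moreover have "norm z \<le> norm (z + s k *\<^sub>R b) + norm (s k *\<^sub>R b)"
      by (metis add_diff_cancel norm_triangle_ineq4)
    moreover have "0 \<le> norm b" by simp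
    ultimately have "r \<le> norm (z + s k *\<^sub>R b)" "r \<le> norm z" using that
      unfolding mem_cball_0 by linarith+
    then show ?thesis using supp by (simp add: X_def)
  qed
  have "(\<lambda>k. integral\<^sup>L lborel (X k)) \<longlonglongrightarrow> integral\<^sup>L lborel (\<lambda>z. D z b)"
  proof (rule integral_dominated_convergence[where w="\<lambda>z. indicator (cball 0 (r + norm b)) z * C"])
    show "(\<lambda>z. D z b) \<in> borel_measurable lborel" using borel_measurable_continuous_onI[OF cont] by simp
    show "X k \<in> borel_measurable lborel" for k
      unfolding X_def using borel_measurable_continuous_onI[OF gcont] by measurable
    show "integrable lborel (\<lambda>z. indicator (cball 0 (r + norm b)) z * C :: real)"
      by (intro integrable_mult_left integrable_real_indicator)
         (use emeasure_bounded_finite[OF bounded_cball] in \<open>auto simp: top.not_eq_extremum\<close>)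
    show "AE z in lborel. norm (X k z) \<le> indicator (cball 0 (r + norm b)) z * C" for k
      using XC Xsupp by (auto simp: indicator_def intro!: AE_I2)
    have "(\<lambda>k. X k z) \<longlonglongrightarrow> D z b" for z
    proof -
      have "((\<lambda>h. (g (z + h *\<^sub>R b) - g z) / h) \<longlongrightarrow> D z b) (at 0)"
        using line[of z 0] by (simp add: DERIV_def)
      then have "((\<lambda>h. (g (z + h *\<^sub>R b) - g z) / h) \<circ> s) \<longlonglongrightarrow> D z b"
        by (rule tendsto_at_iff_sequentially[THEN iffD1, rule_format])
           (use s s0 in \<open>auto simp: less_imp_neq[symmetric]\<close>)
      then show ?thesis by (simp add: X_def comp_def)
    qed
    then show "AE z in lborel. (\<lambda>k. X k z) \<longlonglongrightarrow> D z b" by simp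
  qed
  then have "integral\<^sup>L lborel (\<lambda>z. D z b) = 0" using X0 by (simp add: LIMSEQ_const_iff)
  then show ?zero
    using borel_measurable_continuous_onI[OF cont] by (simp add: integral_completion)
  show ?integrable
    by (rule integrable_lebesgue_bounded_support[OF borel_measurable_lebesgue_continuous[OF cont] C,
          where a=0 and r=r]) (simp add: D0)
qed


section \<open>Cutoff functions\<close>

text \<open>A quadratic spline of class C^1 that rises from 0 to 1 on [1, 2]. It starts at 1 rather
  than 0 so that \<open>smooth_step (y / \<epsilon>)\<close> vanishes on the whole strip y <=
  \<epsilon>, which makes cut-off functions compactly supported in the open half-space.\<close>

definition smooth_step :: "real \<Rightarrow> real" where
  "smooth_step t = 2 * (max 0 (t - 1))\<^sup>2 - 4 * (max 0 (t - 3/2))\<^sup>2 + 2 * (max 0 (t - 2))\<^sup>2"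

text \<open>The tent over [1, 2] with apex 2 at 3/2 and area 1; hence
  \<open>hat (y / \<epsilon>) / \<epsilon>\<close> is an averaging weight in y on the layer between
  \<epsilon> and 2 \<epsilon>.\<close>

definition hat :: "real \<Rightarrow> real" where
  "hat t = 4 * max 0 (t - 1) - 8 * max 0 (t - 3/2) + 4 * max 0 (t - 2)"

lemma smooth_step_deriv: "(smooth_step has_real_derivative hat t) (at t)"
proof -
  have "((\<lambda>x. (max 0 (x - c))\<^sup>2) has_real_derivative 2 * max 0 (t - c)) (at t)" for c :: real
    by (rule DERIV_chain2[where f="\<lambda>x. (max 0 x)\<^sup>2" and g="\<lambda>x. x - c" and Db=1, THEN DERIV_cong])
       (use has_real_derivative_pos_part_power[of 0 "t - c"] in
         \<open>auto simp: numeral_2_eq_2 intro!: derivative_eq_intros\<close>)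
  note d = this[THEN DERIV_cmult]
  show ?thesis
    unfolding smooth_step_def[abs_def]
    by (rule DERIV_cong[OF DERIV_add[OF DERIV_diff[OF d d] d]]) (simp add: hat_def)
qed

lemma smooth_step_eq_0: "t \<le> 1 \<Longrightarrow> smooth_step t = 0"
  by (simp add: smooth_step_def)

lemma smooth_step_eq_1: "2 \<le> t \<Longrightarrow> smooth_step t = 1"
  by (simp add: smooth_step_def power2_eq_square algebra_simps)

lemma hat_eq_0: "t \<le> 1 \<Longrightarrow> hat t = 0"
  by (simp add: hat_def max_def)

lemma hat_nonneg: "0 \<le> hat t"
  by (simp add: hat_def max_def)

lemma hat_le: "hat t \<le> 2"
  by (simp add: hat_def max_def)

lemma smooth_step_bounds: "0 \<le> smooth_step t" "smooth_step t \<le> 1"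
proof -
  have mono: "smooth_step a \<le> smooth_step b" if "a \<le> b" for a b
    by (rule DERIV_nonneg_imp_nondecreasing[OF that]) (use smooth_step_deriv hat_nonneg in blast)
  show "0 \<le> smooth_step t" using mono[of "min t 0" t] by (simp add: smooth_step_eq_0)
  show "smooth_step t \<le> 1" using mono[of t "max t 2"] by (simp add: smooth_step_eq_1)
qed

lemma continuous_on_hat: "continuous_on S f \<Longrightarrow> continuous_on S (\<lambda>x. hat (f x))"
  unfolding hat_def by (intro continuous_intros)

lemma continuous_on_smooth_step: "continuous_on S f \<Longrightarrow> continuous_on S (\<lambda>x. smooth_step (f x))"
  unfolding smooth_step_def by (intro continuous_intros)

lemma smooth_step_has_derivative:
  fixes z :: "'a::real_normed_vector \<times> real"
  shows "((\<lambda>z. smooth_step (snd z / \<epsilon>)) has_derivative (\<lambda>h. hat (snd z / \<epsilon>) / \<epsilon> * snd h)) (at z)"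
proof -
  have "((\<lambda>z. smooth_step (snd z / \<epsilon>)) has_derivative (\<lambda>h. hat (snd z / \<epsilon>) * (snd h / \<epsilon>))) (at z)"
    \<comment> \<open>For \<epsilon> = 0 the quotients are 0 by convention, so the function is
      constant and the formula still holds.\<close>
    by (rule has_derivative_compose[OF _ smooth_step_deriv[unfolded has_field_derivative_def],
          where f="\<lambda>z. snd z / \<epsilon>"])
       (cases "\<epsilon> = 0"; auto intro!: derivative_eq_intros)
  then show ?thesis by simp
qed

text \<open>\<open>t\<close> is the squared radius of the support, not the radius: then the
  truncated paraboloid is piecewise linear in \<open>t\<close>, and its averages can be
  differentiated in \<open>t\<close>. Its square is C^1 and its cube C^2, enough for first-order and
  second-order testing.\<close>

definition bump :: "'a::euclidean_space \<Rightarrow> real \<Rightarrow> 'a \<Rightarrow> real" where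
  "bump a t z = max 0 (t - (norm (z - a))\<^sup>2)"

lemma bump_nonneg: "0 \<le> bump a t z" by (simp add: bump_def)

lemma continuous_on_bump: "continuous_on S (bump a t)"
  unfolding bump_def[abs_def] by (intro continuous_intros)

lemma bump_le: "0 \<le> t \<Longrightarrow> bump a t z \<le> t"
  by (simp add: bump_def)

lemma bump_eq_0: "0 \<le> t \<Longrightarrow> sqrt t \<le> norm (z - a) \<Longrightarrow> bump a t z = 0"
  using real_sqrt_le_iff[of t "(norm (z - a))\<^sup>2"] by (simp add: bump_def)

lemma bump_eq_0_norm: "0 \<le> t \<Longrightarrow> norm a + sqrt t \<le> norm z \<Longrightarrow> bump a t z = 0"
  using norm_triangle_ineq2[of z a] by (intro bump_eq_0) auto

lemma bump_power_has_derivative: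
  "((\<lambda>z. bump a t z ^ Suc (Suc k)) has_derivative
     (\<lambda>h. - 2 * real (Suc (Suc k)) * bump a t z ^ Suc k * ((z - a) \<bullet> h))) (at z)"
proof -
  have "((\<lambda>z. t - (norm (z - a))\<^sup>2) has_derivative (\<lambda>h. - (2 * ((z - a) \<bullet> h)))) (at z)"
    unfolding power2_norm_eq_inner
    by (auto intro!: derivative_eq_intros simp: inner_commute)
  from has_derivative_compose[OF this
      has_real_derivative_pos_part_power[unfolded has_field_derivative_def]]
  show ?thesis
    unfolding bump_def by (rule has_derivative_eq_rhs) (simp add: fun_eq_iff algebra_simps)
qed

lemma bump2_has_derivative:
  "((\<lambda>z. (bump a t z)\<^sup>2) has_derivative (\<lambda>h. - 4 * bump a t z * ((z - a) \<bullet> h))) (at z)"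
  using bump_power_has_derivative[of a t 0 z] by (simp add: numeral_2_eq_2)

lemma bump3_has_derivative:
  "((\<lambda>z. bump a t z ^ 3) has_derivative (\<lambda>h. - 6 * (bump a t z)\<^sup>2 * ((z - a) \<bullet> h))) (at z)"
  using bump_power_has_derivative[of a t 1 z] by (simp add: numeral_3_eq_3 numeral_2_eq_2)

lemma bump3_second_derivative:
  "((\<lambda>z. - 6 * (bump a t z)\<^sup>2 * ((z - a) \<bullet> b)) has_derivative
     (\<lambda>h. 24 * bump a t z * ((z - a) \<bullet> h) * ((z - a) \<bullet> b) - 6 * (bump a t z)\<^sup>2 * (h \<bullet> b))) (at z)"
proof -
  have "((\<lambda>z. (- 6 * (bump a t z)\<^sup>2) * ((z - a) \<bullet> b)) has_derivative
     (\<lambda>h. (- 6 * (bump a t z)\<^sup>2) * (h \<bullet> b) + - 6 * (- 4 * bump a t z * ((z - a) \<bullet> h)) * ((z - a) \<bullet> b))) (at z)"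
    by (rule has_derivative_mult[OF has_derivative_mult_right[OF bump2_has_derivative]])
       (auto intro!: derivative_eq_intros)
  then show ?thesis by (rule has_derivative_eq_rhs) (simp add: fun_eq_iff algebra_simps)
qed

lemma bump3_laplacian:
  fixes a z :: "'a::euclidean_space"
  shows "(\<Sum>b\<in>Basis. 24 * bump a t z * ((z - a) \<bullet> b) * ((z - a) \<bullet> b) - 6 * (bump a t z)\<^sup>2 * (b \<bullet> b))
    = 24 * bump a t z * (norm (z - a))\<^sup>2 - 6 * real DIM('a) * (bump a t z)\<^sup>2"
proof -
  have "(\<Sum>b\<in>Basis. ((z - a) \<bullet> b) * ((z - a) \<bullet> b)) = (norm (z - a))\<^sup>2"
    unfolding power2_norm_eq_inner by (rule euclidean_inner[symmetric])
  then show ?thesis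
    by (simp add: sum_subtractf mult.assoc sum_distrib_left[symmetric])
qed

section \<open>Functions of class C^1 and elementary facts on the half-space\<close>

lemma Ck_on_1I:
  assumes "\<And>z. z \<in> S \<Longrightarrow> (f has_derivative D z) (at z)"
    and "\<And>b. b \<in> Basis \<Longrightarrow> continuous_on S (\<lambda>z. D z b)"
  shows "Ck_on 1 S f"
proof -
  have "continuous_on S (\<lambda>z. frechet_derivative f (at z) b)" if "b \<in> Basis" for b
    using assms(2)[OF that]
    by (rule continuous_on_eq) (simp add: frechet_derivative_eqI[OF assms(1)])
  then show ?thesis using assms(1) by (auto simp: differentiable_def)
qed

lemma Ck_on_1D:
  assumes "Ck_on 1 S f"
  shows "\<And>z. z \<in> S \<Longrightarrow> (f has_derivative frechet_derivative f (at z)) (at z)"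
    and "\<And>b. b \<in> Basis \<Longrightarrow> continuous_on S (\<lambda>z. frechet_derivative f (at z) b)"
    and "continuous_on S f"
proof -
  show d: "(f has_derivative frechet_derivative f (at z)) (at z)" if "z \<in> S" for z
    using assms that by (simp add: frechet_derivative_works)
  show "\<And>b. b \<in> Basis \<Longrightarrow> continuous_on S (\<lambda>z. frechet_derivative f (at z) b)"
    using assms by simp
  show "continuous_on S f"
    using has_derivative_continuous[OF d] continuous_at_imp_continuous_on by auto
qed

lemma open_half_space: "open half_space"
  unfolding half_space_def by (intro open_Collect_less continuous_intros)

lemma open_half_ball: "open (half_ball r :: ((real ^ 'n) \<times> real) set)"
proof -
  have "half_ball r = (half_space :: ((real ^ 'n) \<times> real) set) \<inter> ball 0 r" by (auto simp: half_ball_def)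
  then show ?thesis using open_half_space by auto
qed

lemma half_space_iff: "z \<in> half_space \<longleftrightarrow> 0 < snd z" by (simp add: half_space_def)

lemma half_ball_iff: "z \<in> half_ball r \<longleftrightarrow> 0 < snd z \<and> norm z < r"
  by (simp add: half_ball_def half_space_def)

lemma vertical_Basis: "(0, 1) \<in> (Basis :: ('a::euclidean_space \<times> real) set)"
  by (simp add: Basis_prod_def)

lemma inner_vertical: "z \<bullet> (0, 1) = snd z" for z :: "'a::euclidean_space \<times> real"
  by (simp add: inner_prod_def)


section \<open>Zero boundary values\<close>

lemma integrable_mult_bounded:
  fixes f m :: "'a \<Rightarrow> real"
  assumes f: "integrable M f" and m: "m \<in> borel_measurable M" and b: "\<And>z. \<bar>m z\<bar> \<le> C"
  shows "integrable M (\<lambda>z. f z * m z)"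
proof (rule Bochner_Integration.integrable_bound)
  show "integrable M (\<lambda>z. C * f z)" using f by simp
  show "(\<lambda>z. f z * m z) \<in> borel_measurable M"
    using borel_measurable_integrable[OF f] m by simp
  have "0 \<le> C" using b abs_ge_zero order_trans by blast
  then have "\<bar>f z * m z\<bar> \<le> \<bar>C * f z\<bar>" for z
    using mult_left_mono[OF b[of z] abs_ge_zero[of "f z"]] by (simp add: abs_mult mult.commute)
  then show "AE z in M. norm (f z * m z) \<le> norm (C * f z)" by simp
qed

text \<open>Plays the role of Cauchy-Schwarz for integrals over sets of finite measure: an L^1 norm
  is bounded by \<delta> times a volume plus 1/\<delta> times a squared L^2 norm.\<close>

lemma le_scaled_square: "\<bar>c::real\<bar> \<le> \<delta> + c\<^sup>2 / \<delta>" if "0 < \<delta>"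
proof (cases "\<bar>c\<bar> \<le> \<delta>")
  case False
  then have "\<bar>c\<bar> * \<delta> \<le> \<bar>c\<bar> * \<bar>c\<bar>" by (intro mult_left_mono) auto
  then have "\<bar>c\<bar> \<le> c\<^sup>2 / \<delta>" using that by (simp add: field_simps power2_eq_square)
  then show ?thesis using that by simp
next
  case True
  moreover have "0 \<le> c\<^sup>2 / \<delta>" using that by simp
  ultimately show ?thesis by linarith
qed

lemma integrable_of_square_finite:
  fixes f :: "'a::euclidean_space \<Rightarrow> real"
  assumes B: "B \<in> sets lebesgue" "emeasure lebesgue B < \<infinity>"
    and f: "(\<lambda>z. indicator B z * f z) \<in> borel_measurable lebesgue"
    and q: "\<And>z. (f z)\<^sup>2 \<le> q z" "(\<integral>\<^sup>+z\<in>B. ennreal (q z) \<partial>lebesgue) < \<infinity>"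
  shows "integrable lebesgue (\<lambda>z. indicator B z * f z)"
proof (rule integrableI_bounded[OF f])
  let ?g = "\<lambda>z. indicator B z * f z"
  have "(\<integral>\<^sup>+z. ennreal (norm (?g z)) \<partial>lebesgue) \<le> (\<integral>\<^sup>+z. indicator B z + ennreal ((?g z)\<^sup>2) \<partial>lebesgue)"
  proof (intro nn_integral_mono)
    fix z
    show "ennreal (norm (?g z)) \<le> indicator B z + ennreal ((?g z)\<^sup>2)"
      using ennreal_leI[OF le_scaled_square[of 1 "f z"]] by (auto simp: indicator_def)
  qed
  also have "\<dots> = emeasure lebesgue B + (\<integral>\<^sup>+z. ennreal ((?g z)\<^sup>2) \<partial>lebesgue)"
    using B f by (subst nn_integral_add) auto
  also have "(\<integral>\<^sup>+z. ennreal ((?g z)\<^sup>2) \<partial>lebesgue) \<le> (\<integral>\<^sup>+z\<in>B. ennreal (q z) \<partial>lebesgue)"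
    by (intro nn_integral_mono) (auto simp: indicator_def intro!: ennreal_leI q)
  also have "emeasure lebesgue B + (\<integral>\<^sup>+z\<in>B. ennreal (q z) \<partial>lebesgue) < \<infinity>" using B q by (simp add: less_top)
  finally show "(\<integral>\<^sup>+z. ennreal (norm (?g z)) \<partial>lebesgue) < \<infinity>" by auto
qed

text \<open>Two different mechanisms make the product C^1 after extension by zero:
  \<open>\<phi>\<close> vanishes near the flat part y = 0 of the boundary, and \<open>\<psi>\<close>
  vanishes near the spherical part because \<open>r0 < r\<close>. Neither factor need vanish on the
  other part.\<close>

lemma
  fixes \<phi> \<psi> :: "(real ^ 'n) \<times> real \<Rightarrow> real"
  assumes \<phi>: "C1c_on (closure (half_ball r) - {z. snd z = 0}) \<phi>"
    and \<psi>: "\<And>z. (\<psi> has_derivative \<psi>' z) (at z)" "\<And>b. b \<in> Basis \<Longrightarrow> continuous_on UNIV (\<lambda>z. \<psi>' z b)"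
    and supp: "\<And>z. r0 \<le> norm z \<Longrightarrow> \<psi> z = 0" and r: "r0 < r" and b: "b \<in> Basis"
  shows integrable_half_ball_product_rule: "integrable lebesgue (\<lambda>z. indicator (half_ball r) z *
      (\<phi> z * \<psi>' z b + frechet_derivative \<phi> (at z) b * \<psi> z))" (is ?int)
    and integral_half_ball_product_rule: "integral\<^sup>L lebesgue (\<lambda>z. indicator (half_ball r) z *
      (\<phi> z * \<psi>' z b + frechet_derivative \<phi> (at z) b * \<psi> z)) = 0" (is ?zero)
proof -
  let ?B = "half_ball r :: ((real ^ 'n) \<times> real) set"
  let ?A = "closure ?B - {z. snd z = 0}"
  obtain U K where U: "open U" "?A \<subseteq> U" "Ck_on 1 U \<phi>"
    and K: "compact K" "K \<subseteq> ?A" "\<And>z. z \<in> ?A - K \<Longrightarrow> \<phi> z = 0"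
    using \<phi> unfolding C1c_on_def by blast
  have BA: "?B \<subseteq> ?A" using closure_subset by (auto simp: half_ball_iff)
  have "?B \<subseteq> {z. 0 \<le> snd z}" by (auto simp: half_ball_iff)
  then have clB: "closure ?B \<subseteq> {z. 0 \<le> snd z}"
    by (rule closure_minimal) (intro closed_Collect_le continuous_intros)
  define g where "g z = indicator ?B z * (\<phi> z * \<psi> z)" for z
  define D where "D z h = indicator ?B z * (\<phi> z * \<psi>' z h + frechet_derivative \<phi> (at z) h * \<psi> z)" for z h
  \<comment> \<open>An open set on which the product is 0 and which together with the half-ball
    covers the space: points with y <= 0 lie outside \<open>K\<close>, and all other points outside
    the half-ball have norm at least \<open>r\<close>, which exceeds \<open>r0\<close>.\<close>
  define V where "V = {z. r0 < norm z} \<union> - K"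
  have V: "open V" unfolding V_def
    by (intro open_Un open_Collect_less continuous_intros) (use K in \<open>simp add: compact_imp_closed\<close>)
  have UN: "?B \<union> V = UNIV"
  proof -
    have "z \<in> V" if "z \<notin> ?B" for z
    proof (cases "snd z \<le> 0")
      case True then have "z \<notin> ?A" using clB by auto
      then show ?thesis using K by (auto simp: V_def)
    next
      case False then show ?thesis using that r by (auto simp: V_def half_ball_iff)
    qed
    then show ?thesis by auto
  qed
  have gV: "g z = 0" if "z \<in> V" for z
    using that supp[of z] K(3)[of z] BA by (auto simp: g_def V_def indicator_def)
  have derB: "(g has_derivative D z) (at z)" if "z \<in> ?B" for z
  proof -
    have "((\<lambda>z. \<phi> z * \<psi> z) has_derivative D z) (at z)"
      unfolding D_def using that BA U
      by (auto intro!: derivative_eq_intros Ck_on_1D(1)[OF U(3)] \<psi>(1))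
    then show ?thesis
      by (rule has_derivative_transform_within_open[OF _ open_half_ball that]) (simp add: g_def)
  qed
  have derV: "(g has_derivative (\<lambda>_. 0)) (at z)" if "z \<in> V" for z
    by (rule has_derivative_transform_within_open[OF has_derivative_const V that]) (simp add: gV)
  have DV: "D z = (\<lambda>_. 0)" if "z \<in> V" for z
  proof (cases "z \<in> ?B")
    case True then show ?thesis using derB derV[OF that] has_derivative_unique by blast
  qed (simp add: D_def fun_eq_iff)
  have der: "(g has_derivative D z) (at z)" for z
  proof (cases "z \<in> ?B")
    case False
    then have "z \<in> V" using UN by blast
    then show ?thesis using derV DV by simp
  qed (rule derB)
  have "continuous_on (?B \<union> V) (\<lambda>z. D z b)"
  proof (rule continuous_on_open_Un[OF open_half_ball V])
    have "continuous_on ?B (\<lambda>z. \<phi> z * \<psi>' z b + frechet_derivative \<phi> (at z) b * \<psi> z)"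
      using BA U(2) has_derivative_continuous[OF \<psi>(1)]
      by (intro continuous_intros continuous_on_subset[OF Ck_on_1D(2)[OF U(3) b]]
          continuous_on_subset[OF Ck_on_1D(3)[OF U(3)]] continuous_on_subset[OF \<psi>(2)[OF b]]
          continuous_at_imp_continuous_on) auto
    then show "continuous_on ?B (\<lambda>z. D z b)"
      by (rule continuous_on_eq) (simp add: D_def)
    show "continuous_on V (\<lambda>z. D z b)"
      by (rule continuous_on_eq[OF continuous_on_const[of _ 0]]) (simp add: DV)
  qed
  then have cont: "continuous_on UNIV (\<lambda>z. D z b)" by (simp only: UN)
  have "g z = 0" if "r \<le> norm z" for z using that by (simp add: g_def half_ball_iff)
  from integrable_directional_derivative[OF der cont this]
    integral_directional_derivative_eq_0[OF der cont this]
  show ?int ?zero by (simp_all add: D_def)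
qed

text \<open>Local integrability gives measurability on compact subsets only; the half-space is
  exhausted by countably many of them.\<close>

lemma measurable_weak_gradient:
  fixes G :: "(real ^ 'n) \<times> real \<Rightarrow> (real ^ 'n) \<times> real"
  assumes "G locally_integrable_on half_space"
  shows "(\<lambda>z. indicator half_space z *\<^sub>R G z) \<in> borel_measurable lebesgue"
proof -
  define K :: "nat \<Rightarrow> ((real ^ 'n) \<times> real) set"
    where "K k = cball 0 (real k) \<inter> {z. 1 / real (Suc k) \<le> snd z}" for k
  have K: "compact (K k)" "K k \<subseteq> half_space" for k
  proof -
    show "compact (K k)" unfolding K_def
      by (intro compact_Int_closed compact_cball closed_Collect_le continuous_intros)
    have "0 < snd z" if "1 / real (Suc k) \<le> snd z" for z :: "(real ^ 'n) \<times> real"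
      using that by (rule less_le_trans[rotated]) simp
    then show "K k \<subseteq> half_space" by (auto simp: K_def half_space_iff)
  qed
  show ?thesis
  proof (rule borel_measurable_LIMSEQ_metric)
    show "(\<lambda>z. indicator (K k) z *\<^sub>R G z) \<in> borel_measurable lebesgue" for k
    proof -
      have "set_integrable lebesgue (K k) G"
        using assms K[of k] unfolding locally_integrable_on_def by blast
      then show ?thesis unfolding set_integrable_def by (rule borel_measurable_integrable)
    qed
    fix z :: "(real ^ 'n) \<times> real"
    have "\<forall>\<^sub>F k in sequentially. indicator (K k) z *\<^sub>R G z = indicator half_space z *\<^sub>R G z"
    proof (cases "z \<in> half_space")
      case True
      then have "0 < snd z" by (simp add: half_space_iff)
      then obtain k1 where k1: "inverse (real (Suc k1)) < snd z" using reals_Archimedean by blast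
      obtain k2 where k2: "norm z \<le> real k2" using real_arch_simple by blast
      have "z \<in> K k" if "max k1 k2 \<le> k" for k
      proof -
        have "1 / real (Suc k) \<le> inverse (real (Suc k1))" using that by (simp add: field_simps)
        then show ?thesis using that k1 k2 by (auto simp: K_def)
      qed
      then show ?thesis using True by (auto simp: eventually_sequentially intro!: exI[of _ "max k1 k2"])
    next
      case False
      then have "z \<notin> K k" for k using K(2) by blast
      then show ?thesis using False by simp
    qed
    then show "(\<lambda>k. indicator (K k) z *\<^sub>R G z) \<longlonglongrightarrow> indicator half_space z *\<^sub>R G z"
      by (rule tendsto_eventually)
  qed
qed

text \<open>The test functions for the weak gradient. The ball of the bump may cross y = 0; the step
  cuts the support off at height \<epsilon>.\<close>

lemma C1c_on_half_space_cutoff_bump: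
  fixes a :: "(real ^ 'n) \<times> real"
  assumes t: "0 \<le> t" and e: "0 < \<epsilon>"
  shows "C1c_on half_space (\<lambda>z. smooth_step (snd z / \<epsilon>) * (bump a t z)\<^sup>2)"
    and "((\<lambda>z. smooth_step (snd z / \<epsilon>) * (bump a t z)\<^sup>2) has_derivative
      (\<lambda>h. hat (snd z / \<epsilon>) / \<epsilon> * snd h * (bump a t z)\<^sup>2 +
           smooth_step (snd z / \<epsilon>) * (- 4 * bump a t z * ((z - a) \<bullet> h)))) (at z)"
proof -
  let ?f = "\<lambda>z. smooth_step (snd z / \<epsilon>) * (bump a t z)\<^sup>2"
  let ?D = "\<lambda>z h. hat (snd z / \<epsilon>) / \<epsilon> * snd h * (bump a t z)\<^sup>2 +
           smooth_step (snd z / \<epsilon>) * (- 4 * bump a t z * ((z - a) \<bullet> h))"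
  show der: "(?f has_derivative ?D z) (at z)" for z
    by (rule has_derivative_eq_rhs[OF has_derivative_mult[OF smooth_step_has_derivative bump2_has_derivative]])
       (simp add: fun_eq_iff)
  have "Ck_on 1 UNIV ?f"
    by (rule Ck_on_1I[OF der])
       (use e in \<open>intro continuous_intros continuous_on_hat continuous_on_smooth_step continuous_on_bump; simp\<close>)
  moreover have "\<exists>K. compact K \<and> K \<subseteq> half_space \<and> (\<forall>z\<in>half_space - K. ?f z = 0)"
  proof (intro exI[of _ "cball 0 (norm a + sqrt t) \<inter> {z. \<epsilon> \<le> snd z}"] conjI ballI)
    show "compact (cball 0 (norm a + sqrt t) \<inter> {z :: (real ^ 'n) \<times> real. \<epsilon> \<le> snd z})"
      by (intro compact_Int_closed compact_cball closed_Collect_le continuous_intros)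
    fix z :: "(real ^ 'n) \<times> real" assume z: "z \<in> half_space - cball 0 (norm a + sqrt t) \<inter> {z. \<epsilon> \<le> snd z}"
    then consider "norm a + sqrt t \<le> norm z" | "snd z / \<epsilon> \<le> 1" using e by fastforce
    then show "?f z = 0" by cases (simp_all add: smooth_step_eq_0 bump_eq_0_norm t)
  qed (use e in \<open>auto simp: half_space_iff\<close>)
  ultimately show "C1c_on half_space ?f" unfolding C1c_on_def by blast
qed

text \<open>This is the meaning of zero trace: \<open>\<psi>\<close> need not vanish on y = 0, yet
  no boundary term appears. For the approximants \<open>\<phi> k\<close> the identity is the product
  rule above, and it passes to the L^2 limit because \<open>\<psi>\<close> and its vertical
  derivative are bounded on the half-ball.\<close>

lemma integral_by_parts_vertical_H10_tilde:
  fixes w :: "(real ^ 'n) \<times> real \<Rightarrow> real" and G :: "(real ^ 'n) \<times> real \<Rightarrow> (real ^ 'n) \<times> real" and r :: real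
  defines "B \<equiv> half_ball r :: ((real ^ 'n) \<times> real) set"
  assumes iw: "integrable lebesgue (\<lambda>z. indicator B z * w z)"
    and iG: "integrable lebesgue (\<lambda>z. indicator B z * (G z \<bullet> (0, 1)))"
    and mG: "(\<lambda>z. indicator half_space z *\<^sub>R G z) \<in> borel_measurable lebesgue"
    and wc: "continuous_on half_space w"
    and \<phi>: "\<And>k. C1c_on (closure B - {z. snd z = 0}) (\<phi> k)"
    and lim: "(\<lambda>k. \<integral>\<^sup>+z\<in>B. ennreal ((norm (G z - gradient (\<phi> k) z))\<^sup>2 + \<bar>w z - \<phi> k z\<bar>\<^sup>2) \<partial>lebesgue)
             \<longlonglongrightarrow> 0"
    and \<psi>: "\<And>z. (\<psi> has_derivative \<psi>' z) (at z)" "\<And>b. b \<in> Basis \<Longrightarrow> continuous_on UNIV (\<lambda>z. \<psi>' z b)"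
    and supp: "\<And>z. \<rho> \<le> norm z \<Longrightarrow> \<psi> z = 0" and r: "\<rho> < r"
    and bd: "\<And>z. \<bar>\<psi> z\<bar> \<le> C" "\<And>z. z \<in> B \<Longrightarrow> \<bar>\<psi>' z (0, 1)\<bar> \<le> C"
  shows "integral\<^sup>L lebesgue (\<lambda>z. indicator B z * w z * \<psi>' z (0, 1) + indicator B z * (G z \<bullet> (0, 1)) * \<psi> z) = 0"
proof -
  let ?e = "(0, 1) :: (real ^ 'n) \<times> real"
  let ?F = "\<lambda>z. indicator B z * w z * \<psi>' z ?e + indicator B z * (G z \<bullet> ?e) * \<psi> z"
  define I where "I = integral\<^sup>L lebesgue ?F"
  define q where "q k z = (norm (G z - gradient (\<phi> k) z))\<^sup>2 + \<bar>w z - \<phi> k z\<bar>\<^sup>2" for k z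
  have C: "0 \<le> C" using bd(1) abs_ge_zero order_trans by blast
  have Bo: "open B" unfolding B_def by (rule open_half_ball)
  have BH: "B \<subseteq> half_space" by (auto simp: B_def half_ball_iff half_space_iff)
  have Bb: "bounded B" by (rule bounded_subset[OF bounded_ball[of 0 r]]) (auto simp: B_def half_ball_iff)
  have Bs: "B \<in> sets lebesgue" using Bo by simp
  have Bfin: "emeasure lebesgue B < \<infinity>"
    using emeasure_bounded_finite[OF Bb] Bo by simp
  have \<psi>c: "continuous_on UNIV \<psi>"
    by (intro continuous_at_imp_continuous_on ballI has_derivative_continuous[OF \<psi>(1)])
  note \<psi>m = borel_measurable_lebesgue_continuous[OF \<psi>c]
    borel_measurable_lebesgue_continuous[OF \<psi>(2)[OF vertical_Basis]]
  have on_B: "(\<lambda>z. indicator B z *\<^sub>R f z) \<in> borel_measurable lebesgue"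
    if "continuous_on B f" for f :: "(real ^ 'n) \<times> real \<Rightarrow> 'b::euclidean_space"
    using borel_measurable_continuous_on_indicator[OF _ that] Bo
    by (intro measurable_completion) auto
  have BA: "B \<subseteq> closure B - {z. snd z = 0}"
    using closure_subset by (auto simp: B_def half_ball_iff)
  have \<phi>1: "Ck_on 1 B (\<phi> k)" for k
  proof -
    obtain U where U: "closure B - {z. snd z = 0} \<subseteq> U" "Ck_on 1 U (\<phi> k)"
      using \<phi>[of k] unfolding C1c_on_def by blast
    then have BU: "B \<subseteq> U" using BA by blast
    show ?thesis
      by (rule Ck_on_1I[OF Ck_on_1D(1)[OF U(2)]])
         (use BU in \<open>auto intro: continuous_on_subset[OF Ck_on_1D(2)[OF U(2)]]\<close>)
  qed
  have grad_e: "gradient (\<phi> k) z \<bullet> ?e = frechet_derivative (\<phi> k) (at z) ?e" for k z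
    unfolding gradient_def using vertical_Basis[where 'a="real ^ 'n"]
    by (simp add: inner_sum_left inner_Basis if_distrib[of "\<lambda>x. _ * x"] cong: if_cong)
  have mq: "(\<lambda>z. indicator B z * q k z) \<in> borel_measurable lebesgue" for k
  proof -
    have 1: "(\<lambda>z. indicator B z *\<^sub>R G z) \<in> borel_measurable lebesgue"
    proof -
      have "(\<lambda>z. indicator B z *\<^sub>R (indicator half_space z *\<^sub>R G z)) \<in> borel_measurable lebesgue"
        by (rule borel_measurable_scaleR[OF _ mG]) (use Bs in simp)
      moreover have "indicator B z *\<^sub>R (indicator half_space z *\<^sub>R G z) = indicator B z *\<^sub>R G z" for z
        using BH by (auto simp: indicator_def)
      ultimately show ?thesis by (simp only:)
    qed
    have 2: "continuous_on B (gradient (\<phi> k))"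
      unfolding gradient_def[abs_def] by (intro continuous_intros Ck_on_1D(2)[OF \<phi>1])
    have 3: "continuous_on B (\<lambda>z. w z - \<phi> k z)"
      by (intro continuous_intros continuous_on_subset[OF wc BH] Ck_on_1D(3)[OF \<phi>1])
    have "(\<lambda>z. (norm (indicator B z *\<^sub>R G z - indicator B z *\<^sub>R gradient (\<phi> k) z))\<^sup>2
        + (indicator B z *\<^sub>R (w z - \<phi> k z))\<^sup>2) \<in> borel_measurable lebesgue"
      using 1 on_B[OF 2] on_B[OF 3] by measurable
    moreover have "(norm (indicator B z *\<^sub>R G z - indicator B z *\<^sub>R gradient (\<phi> k) z))\<^sup>2
        + (indicator B z *\<^sub>R (w z - \<phi> k z))\<^sup>2 = indicator B z * q k z" for z
      by (simp add: indicator_def q_def)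
    ultimately show ?thesis by simp
  qed
  have iF: "integrable lebesgue ?F"
  proof -
    have "integrable lebesgue (\<lambda>z. indicator B z * w z * (indicator B z * \<psi>' z ?e))"
      by (rule integrable_mult_bounded[OF iw, where C=C])
         (use \<psi>m Bs bd(2) C in \<open>auto simp: indicator_def\<close>)
    then have 1: "integrable lebesgue (\<lambda>z. indicator B z * w z * \<psi>' z ?e)"
      by (rule Bochner_Integration.integrable_cong[THEN iffD1, rotated -1]) (auto simp: indicator_def)
    show ?thesis
      by (rule Bochner_Integration.integrable_add[OF 1 integrable_mult_bounded[OF iG \<psi>m(1) bd(1)]])
  qed
  \<comment> \<open>The corresponding integral with \<open>\<phi> k\<close> in place of
    \<open>w\<close> is 0, so \<open>I\<close> is the integral of the difference, which is linear in
    w - \<phi> and in the vertical part of G - \<nabla>\<phi>.\<close>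
  have est: "ennreal \<bar>I\<bar> \<le> ennreal (2 * C * \<delta>) * emeasure lebesgue B
      + ennreal (C / \<delta>) * (\<integral>\<^sup>+z\<in>B. ennreal (q k z) \<partial>lebesgue)" if \<delta>: "0 < \<delta>" for \<delta> k
  proof -
    let ?P = "\<lambda>z. indicator B z * (\<phi> k z * \<psi>' z ?e + frechet_derivative (\<phi> k) (at z) ?e * \<psi> z)"
    have P: "integrable lebesgue ?P" "integral\<^sup>L lebesgue ?P = 0"
      unfolding B_def
      using integrable_half_ball_product_rule[OF \<phi>[of k, unfolded B_def] \<psi> supp r vertical_Basis]
        integral_half_ball_product_rule[OF \<phi>[of k, unfolded B_def] \<psi> supp r vertical_Basis] by auto
    have "I = integral\<^sup>L lebesgue (\<lambda>z. ?F z - ?P z)"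
      unfolding I_def using P iF by simp
    then have "ennreal \<bar>I\<bar> \<le> (\<integral>\<^sup>+z. norm (?F z - ?P z) \<partial>lebesgue)"
      using integral_norm_bound_ennreal[of lebesgue "\<lambda>z. ?F z - ?P z"] P iF by auto
    also have "\<dots> \<le> (\<integral>\<^sup>+z. ennreal (2 * C * \<delta>) * indicator B z +
         ennreal (C / \<delta>) * ennreal (indicator B z * q k z) \<partial>lebesgue)"
    proof (rule nn_integral_mono)
      fix z :: "(real ^ 'n) \<times> real"
      show "ennreal (norm (?F z - ?P z)) \<le> ennreal (2 * C * \<delta>) * indicator B z +
         ennreal (C / \<delta>) * ennreal (indicator B z * q k z)"
      proof (cases "z \<in> B")
        case True
        let ?a = "w z - \<phi> k z" and ?b = "(G z - gradient (\<phi> k) z) \<bullet> ?e"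
        have "\<bar>?b\<bar> \<le> norm (G z - gradient (\<phi> k) z)"
          using Cauchy_Schwarz_ineq2[of "G z - gradient (\<phi> k) z" ?e] by (simp add: norm_prod_def)
        then have "?b\<^sup>2 \<le> (norm (G z - gradient (\<phi> k) z))\<^sup>2"
          by (metis abs_ge_zero power2_abs power_mono)
        then have q: "?a\<^sup>2 + ?b\<^sup>2 \<le> q k z" by (simp add: q_def)
        have "norm (?F z - ?P z) = \<bar>?a * \<psi>' z ?e + ?b * \<psi> z\<bar>"
          using True by (simp add: grad_e inner_diff_left algebra_simps)
        also have "\<dots> \<le> \<bar>?a\<bar> * \<bar>\<psi>' z ?e\<bar> + \<bar>?b\<bar> * \<bar>\<psi> z\<bar>"
          using abs_triangle_ineq[of "?a * \<psi>' z ?e" "?b * \<psi> z"] by (simp only: abs_mult)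
        also have "\<dots> \<le> \<bar>?a\<bar> * C + \<bar>?b\<bar> * C"
          by (intro add_mono mult_left_mono bd True) auto
        also have "\<dots> \<le> (\<delta> + ?a\<^sup>2 / \<delta>) * C + (\<delta> + ?b\<^sup>2 / \<delta>) * C"
          by (intro add_mono mult_right_mono le_scaled_square \<delta> C)
        also have "\<dots> = 2 * C * \<delta> + C / \<delta> * (?a\<^sup>2 + ?b\<^sup>2)"
          by (simp add: algebra_simps add_divide_distrib)
        also have "\<dots> \<le> 2 * C * \<delta> + C / \<delta> * q k z"
          using q C \<delta> by (intro add_left_mono mult_left_mono) auto
        finally have "norm (?F z - ?P z) \<le> 2 * C * \<delta> + C / \<delta> * q k z" .
        moreover have "0 \<le> q k z" by (simp add: q_def)
        ultimately show ?thesis using C \<delta> True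
          by (simp add: ennreal_mult[symmetric] ennreal_plus[symmetric] del: ennreal_plus)
      qed simp
    qed
    also have "\<dots> = ennreal (2 * C * \<delta>) * emeasure lebesgue B
        + ennreal (C / \<delta>) * (\<integral>\<^sup>+z. ennreal (indicator B z * q k z) \<partial>lebesgue)"
      using mq[of k] Bs by (subst nn_integral_add) (auto simp: nn_integral_cmult nn_integral_cmult_indicator)
    also have "(\<integral>\<^sup>+z. ennreal (indicator B z * q k z) \<partial>lebesgue) = (\<integral>\<^sup>+z\<in>B. ennreal (q k z) \<partial>lebesgue)"
      by (intro nn_integral_cong) (simp add: indicator_def)
    finally show ?thesis .
  qed
  define V where "V = measure lebesgue B"
  have VB: "emeasure lebesgue B = ennreal V"
    unfolding V_def using Bfin by (simp add: emeasure_eq_ennreal_measure less_top)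
  \<comment> \<open>The order of limits matters: for fixed \<open>\<delta>\<close> the second term
    dies as k grows, in spite of the factor \<open>C / \<delta>\<close>; only then does
    \<open>\<delta>\<close> tend to 0.\<close>
  have "\<bar>I\<bar> \<le> \<delta> * (2 * C * V)" if \<delta>: "0 < \<delta>" for \<delta>
  proof -
    have "(\<lambda>k. ennreal (2 * C * \<delta>) * emeasure lebesgue B
      + ennreal (C / \<delta>) * (\<integral>\<^sup>+z\<in>B. ennreal (q k z) \<partial>lebesgue)) \<longlonglongrightarrow>
       ennreal (2 * C * \<delta>) * emeasure lebesgue B + ennreal (C / \<delta>) * 0"
      using lim unfolding q_def by (intro tendsto_add tendsto_const ennreal_tendsto_cmult) auto
    then have "ennreal \<bar>I\<bar> \<le> ennreal (2 * C * \<delta>) * emeasure lebesgue B + ennreal (C / \<delta>) * 0"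
      by (rule LIMSEQ_le_const) (use est[OF \<delta>] in auto)
    then have "ennreal \<bar>I\<bar> \<le> ennreal (\<delta> * (2 * C * V))"
      using C \<delta> by (simp add: VB ennreal_mult[symmetric] mult_ac V_def)
    then show ?thesis using C \<delta> by (simp add: V_def)
  qed
  then have "\<bar>I\<bar> \<le> 0"
  proof -
    have "((\<lambda>\<delta>. \<delta> * (2 * C * V)) \<longlongrightarrow> 0 * (2 * C * V)) (at_right 0)" by (intro tendsto_intros)
    moreover have "\<forall>\<^sub>F \<delta> in at_right 0. \<bar>I\<bar> \<le> \<delta> * (2 * C * V)"
      using \<open>\<And>\<delta>. 0 < \<delta> \<Longrightarrow> \<bar>I\<bar> \<le> \<delta> * (2 * C * V)\<close> by (simp add: eventually_at_right_less eventually_at_filter)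
    ultimately show ?thesis using tendsto_lowerbound by force
  qed
  then show ?thesis by (simp add: I_def)
qed

text \<open>Testing the weak gradient with the cut-off bump turns the layer integral into minus the
  integral of (w \<partial>\<psi>/\<partial>y + G \<psi>) times the step, where \<psi> is the
  squared bump and G the vertical component. As the layer shrinks the step tends to 1 on the
  half-space, and the limit is 0 by zero trace.\<close>

lemma H10_tilde_layer_tendsto_0:
  fixes w :: "(real ^ 'n) \<times> real \<Rightarrow> real"
  assumes w: "w \<in> H10_tilde" and wc: "continuous_on half_space w" and t: "0 \<le> t"
    and \<epsilon>: "\<And>k. 0 < \<epsilon> k" "\<epsilon> \<longlonglongrightarrow> 0"
  shows "(\<lambda>k. integral\<^sup>L lebesgue (\<lambda>z. indicator half_space z *
           (w z * (hat (snd z / \<epsilon> k) / \<epsilon> k * (bump a t z)\<^sup>2)))) \<longlonglongrightarrow> 0"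
    and "integrable lebesgue (\<lambda>z. indicator half_space z *
           (w z * (hat (snd z / \<epsilon> k) / \<epsilon> k * (bump a t z)\<^sup>2)))"
proof -
  let ?e = "(0, 1) :: (real ^ 'n) \<times> real"
  let ?H = "half_space :: ((real ^ 'n) \<times> real) set"
  \<comment> \<open>The summand 1 leaves a strict gap between the support of the bump and the sphere
    of radius \<open>r\<close>, as the integration by parts demands.\<close>
  define r where "r = norm a + sqrt t + 1"
  define B where "B = (half_ball r :: ((real ^ 'n) \<times> real) set)"
  have r: "0 < r" unfolding r_def using t real_sqrt_ge_zero[OF t] norm_ge_zero[of a] by linarith
  obtain G where G: "G locally_integrable_on ?H" "weak_gradient_on ?H w G"
    and fin: "(\<integral>\<^sup>+z\<in>B. ennreal ((norm (G z))\<^sup>2 + (w z)\<^sup>2) \<partial>lebesgue) < \<infinity>"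
    and ex: "\<exists>\<phi> :: nat \<Rightarrow> (real ^ 'n) \<times> real \<Rightarrow> real.
           (\<forall>k. C1c_on (closure (half_ball r) - {z. snd z = 0}) (\<phi> k)) \<and>
           (\<lambda>k. \<integral>\<^sup>+z\<in>half_ball r.
                  ennreal ((norm (G z - gradient (\<phi> k) z))\<^sup>2 + \<bar>w z - \<phi> k z\<bar>\<^sup>2) \<partial>lebesgue)
             \<longlonglongrightarrow> 0"
    using w r unfolding H10_tilde_def B_def by blast
  obtain \<phi> where \<phi>: "\<And>k. C1c_on (closure B - {z. snd z = 0}) (\<phi> k)"
    "(\<lambda>k. \<integral>\<^sup>+z\<in>B. ennreal ((norm (G z - gradient (\<phi> k) z))\<^sup>2 + \<bar>w z - \<phi> k z\<bar>\<^sup>2) \<partial>lebesgue)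
             \<longlonglongrightarrow> 0"
    using ex unfolding B_def by blast
  note mG = measurable_weak_gradient[OF G(1)]
  have Bo: "open B" unfolding B_def by (rule open_half_ball)
  have BH: "B \<subseteq> ?H" by (auto simp: B_def half_ball_iff half_space_iff)
  have Bb: "bounded B" by (rule bounded_subset[OF bounded_ball[of 0 r]]) (auto simp: B_def half_ball_iff)
  have Bs: "B \<in> sets lebesgue" using Bo by simp
  have Bfin: "emeasure lebesgue B < \<infinity>" using emeasure_bounded_finite[OF Bb] Bo by simp
  have iw: "integrable lebesgue (\<lambda>z. indicator B z * w z)"
  proof (rule integrable_of_square_finite[OF Bs Bfin _ _ fin])
    have "(\<lambda>z. indicator B z *\<^sub>R w z) \<in> borel_measurable borel"
      by (rule borel_measurable_continuous_on_indicator[OF _ continuous_on_subset[OF wc BH]]) (use Bo in auto)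
    then show "(\<lambda>z. indicator B z * w z) \<in> borel_measurable lebesgue"
      by (simp add: measurable_completion)
  qed simp
  have iG: "integrable lebesgue (\<lambda>z. indicator B z * (G z \<bullet> ?e))"
  proof (rule integrable_of_square_finite[OF Bs Bfin _ _ fin])
    have "(\<lambda>z. indicator B z * ((indicator ?H z *\<^sub>R G z) \<bullet> ?e)) \<in> borel_measurable lebesgue"
      using mG Bs by (intro borel_measurable_times borel_measurable_inner) auto
    moreover have "indicator B z * ((indicator ?H z *\<^sub>R G z) \<bullet> ?e) = indicator B z * (G z \<bullet> ?e)" for z
      using BH by (auto simp: indicator_def)
    ultimately show "(\<lambda>z. indicator B z * (G z \<bullet> ?e)) \<in> borel_measurable lebesgue" by (simp only:)
    fix z
    have "\<bar>G z \<bullet> ?e\<bar> \<le> norm (G z)"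
      using Cauchy_Schwarz_ineq2[of "G z" ?e] by (simp add: norm_prod_def)
    then have "(G z \<bullet> ?e)\<^sup>2 \<le> (norm (G z))\<^sup>2"
      by (metis abs_ge_zero power2_abs power_mono)
    then show "(G z \<bullet> ?e)\<^sup>2 \<le> (norm (G z))\<^sup>2 + (w z)\<^sup>2" by (simp add: add_increasing2)
  qed
  let ?\<psi> = "\<lambda>z. (bump a t z)\<^sup>2"
  let ?\<psi>' = "\<lambda>z h. - 4 * bump a t z * ((z - a) \<bullet> h)"
  have supp: "bump a t z = 0" if "norm a + sqrt t \<le> norm z" for z
    using bump_eq_0_norm[OF t that] .
  have suppB: "bump a t z = 0" if "z \<in> ?H" "z \<notin> B" for z
    using that by (intro supp) (auto simp: B_def half_ball_iff half_space_iff r_def)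
  have bd: "bump a t z \<le> t" "0 \<le> bump a t z" for z using bump_le[OF t] bump_nonneg by auto
  have bd2: "(bump a t z)\<^sup>2 \<le> t\<^sup>2" for z by (intro power_mono bd)
  have bd': "\<bar>?\<psi>' z ?e\<bar> \<le> 4 * t * (r + norm a)" for z
  proof (cases "bump a t z = 0")
    case True then show ?thesis using t r by simp
  next
    case False
    then have "norm z < r" using supp[of z] by (force simp: r_def)
    moreover have "\<bar>(z - a) \<bullet> ?e\<bar> \<le> norm (z - a)"
      using Cauchy_Schwarz_ineq2[of "z - a" ?e] by (simp add: norm_prod_def)
    ultimately have "\<bar>(z - a) \<bullet> ?e\<bar> \<le> r + norm a" using norm_triangle_ineq4[of z a] by linarith
    then have "bump a t z * \<bar>(z - a) \<bullet> ?e\<bar> \<le> t * (r + norm a)" by (intro mult_mono bd) (use t in auto)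
    then show ?thesis using bd(2)[of z] by (simp add: abs_mult)
  qed
  have \<psi>c: "continuous_on UNIV (\<lambda>z. ?\<psi>' z b)" for b
    by (intro continuous_intros continuous_on_bump)
  have \<psi>m: "?\<psi> \<in> borel_measurable lebesgue" "(\<lambda>z. ?\<psi>' z ?e) \<in> borel_measurable lebesgue"
    by (intro borel_measurable_lebesgue_continuous continuous_intros continuous_on_bump)+
  define C where "C = max (t\<^sup>2) (4 * t * (r + norm a))"
  have I0: "integral\<^sup>L lebesgue (\<lambda>z. indicator B z * w z * ?\<psi>' z ?e + indicator B z * (G z \<bullet> ?e) * ?\<psi> z) = 0"
    unfolding B_def
    by (rule integral_by_parts_vertical_H10_tilde[where C=C and \<rho>="norm a + sqrt t" and \<phi>=\<phi>,
          OF iw[unfolded B_def] iG[unfolded B_def] mG wc \<phi>[unfolded B_def] bump2_has_derivative \<psi>c])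
       (use supp bd2 bd' in \<open>auto simp: r_def C_def le_max_iff_disj\<close>)
  have i1: "integrable lebesgue (\<lambda>z. indicator B z * w z * ?\<psi>' z ?e)"
    by (rule integrable_mult_bounded[OF iw \<psi>m(2) bd'])
  have i2: "integrable lebesgue (\<lambda>z. indicator B z * (G z \<bullet> ?e) * ?\<psi> z)"
    by (rule integrable_mult_bounded[OF iG \<psi>m(1), where C="t\<^sup>2"]) (use bd2 in auto)
  let ?s = "\<lambda>k z. smooth_step (snd z / \<epsilon> k)"
  have sm: "?s k \<in> borel_measurable lebesgue" for k
    by (intro borel_measurable_lebesgue_continuous continuous_on_smooth_step continuous_intros)
       (use \<epsilon>(1)[of k] in auto)
  have hm: "(\<lambda>z :: (real ^ 'n) \<times> real. hat (snd z / \<epsilon> k) / \<epsilon> k * (bump a t z)\<^sup>2) \<in> borel_measurable lebesgue" for k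
    by (intro borel_measurable_lebesgue_continuous continuous_on_hat continuous_intros continuous_on_bump)
       (use \<epsilon>(1)[of k] in auto)
  let ?J = "\<lambda>k z. indicator ?H z * (w z * (hat (snd z / \<epsilon> k) / \<epsilon> k * (bump a t z)\<^sup>2))"
  have iJ: "integrable lebesgue (?J k)" for k
  proof -
    have "integrable lebesgue (\<lambda>z. indicator B z * w z * (hat (snd z / \<epsilon> k) / \<epsilon> k * (bump a t z)\<^sup>2))"
    proof (rule integrable_mult_bounded[OF iw hm])
      fix z
      have "hat (snd z / \<epsilon> k) / \<epsilon> k * (bump a t z)\<^sup>2 \<le> 2 / \<epsilon> k * t\<^sup>2"
        using \<epsilon>(1)[of k] by (intro mult_mono divide_right_mono hat_le bd2) auto
      then show "\<bar>hat (snd z / \<epsilon> k) / \<epsilon> k * (bump a t z)\<^sup>2\<bar> \<le> 2 / \<epsilon> k * t\<^sup>2"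
        using \<epsilon>(1)[of k] hat_nonneg[of "snd z / \<epsilon> k"] by simp
    qed
    moreover have "?J k z = indicator B z * w z * (hat (snd z / \<epsilon> k) / \<epsilon> k * (bump a t z)\<^sup>2)" for z
      using BH suppB[of z] by (auto simp: indicator_def)
    ultimately show ?thesis by (simp only:)
  qed
  show "integrable lebesgue (?J k)" by (rule iJ)
  let ?K = "\<lambda>k z. (indicator B z * w z * ?\<psi>' z ?e + indicator B z * (G z \<bullet> ?e) * ?\<psi> z) * ?s k z"
  have sb: "\<bar>?s k z\<bar> \<le> 1" for k z using smooth_step_bounds[of "snd z / \<epsilon> k"] by simp
  have iK: "integrable lebesgue (?K k)" for k
    by (rule integrable_mult_bounded[OF Bochner_Integration.integrable_add[OF i1 i2] sm sb])
  \<comment> \<open>The derivative of the step produces the layer integral, the derivative of the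
    bump a part of \<open>?K k\<close>; the weak gradient identity balances them.\<close>
  have JK: "integral\<^sup>L lebesgue (?J k) = - integral\<^sup>L lebesgue (?K k)" for k
  proof -
    let ?u = "\<lambda>z. ?s k z * ?\<psi> z"
    have fd: "frechet_derivative ?u (at z) ?e = hat (snd z / \<epsilon> k) / \<epsilon> k * ?\<psi> z + ?s k z * ?\<psi>' z ?e" for z
      by (simp add: frechet_derivative_eqI[OF C1c_on_half_space_cutoff_bump(2)[OF t \<epsilon>(1)]])
    have "(LINT z:?H|lebesgue. w z * frechet_derivative ?u (at z) ?e)
        = - (LINT z:?H|lebesgue. (G z \<bullet> ?e) * ?u z)"
      using G(2) C1c_on_half_space_cutoff_bump(1)[OF t \<epsilon>(1)] vertical_Basis
      unfolding weak_gradient_on_def by blast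
    moreover have "(LINT z:?H|lebesgue. w z * frechet_derivative ?u (at z) ?e)
        = integral\<^sup>L lebesgue (\<lambda>z. ?J k z + indicator B z * w z * ?\<psi>' z ?e * ?s k z)"
      unfolding set_lebesgue_integral_def fd
      by (rule Bochner_Integration.integral_cong[OF refl])
         (use BH suppB in \<open>auto simp: indicator_def algebra_simps\<close>)
    moreover have "\<dots> = integral\<^sup>L lebesgue (?J k) + integral\<^sup>L lebesgue (\<lambda>z. indicator B z * w z * ?\<psi>' z ?e * ?s k z)"
      by (rule Bochner_Integration.integral_add[OF iJ integrable_mult_bounded[OF i1 sm sb]])
    moreover have "(LINT z:?H|lebesgue. (G z \<bullet> ?e) * ?u z)
        = integral\<^sup>L lebesgue (\<lambda>z. indicator B z * (G z \<bullet> ?e) * ?\<psi> z * ?s k z)"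
      unfolding set_lebesgue_integral_def
      by (rule Bochner_Integration.integral_cong[OF refl])
         (use BH suppB in \<open>auto simp: indicator_def algebra_simps\<close>)
    moreover have "integral\<^sup>L lebesgue (?K k) =
        integral\<^sup>L lebesgue (\<lambda>z. indicator B z * w z * ?\<psi>' z ?e * ?s k z)
      + integral\<^sup>L lebesgue (\<lambda>z. indicator B z * (G z \<bullet> ?e) * ?\<psi> z * ?s k z)"
      unfolding ring_distribs
      by (rule Bochner_Integration.integral_add[OF integrable_mult_bounded[OF i1 sm sb]
            integrable_mult_bounded[OF i2 sm sb]])
    ultimately show ?thesis by linarith
  qed
  have "(\<lambda>k. integral\<^sup>L lebesgue (?K k)) \<longlonglongrightarrow>
      integral\<^sup>L lebesgue (\<lambda>z. indicator B z * w z * ?\<psi>' z ?e + indicator B z * (G z \<bullet> ?e) * ?\<psi> z)"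
    (is "_ \<longlonglongrightarrow> integral\<^sup>L lebesgue ?L")
  proof (rule integral_dominated_convergence[where w="\<lambda>z. \<bar>?L z\<bar>"])
    show "?L \<in> borel_measurable lebesgue" using i1 i2 by (intro borel_measurable_integrable) auto
    show "?K k \<in> borel_measurable lebesgue" for k using iK by (rule borel_measurable_integrable)
    show "integrable lebesgue (\<lambda>z. \<bar>?L z\<bar>)" using i1 i2 by (intro integrable_abs) auto
    show "AE z in lebesgue. norm (?K k z) \<le> \<bar>?L z\<bar>" for k
      using mult_left_mono[OF sb abs_ge_zero] by (intro AE_I2) (simp add: abs_mult)
    have "(\<lambda>k. ?K k z) \<longlonglongrightarrow> ?L z" for z
    proof (cases "z \<in> B")
      case True
      then have "0 < snd z" by (simp add: B_def half_ball_iff)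
      then have "\<forall>\<^sub>F k in sequentially. \<epsilon> k < snd z / 2"
        by (intro order_tendstoD(2)[OF \<epsilon>(2)]) auto
      then have "\<forall>\<^sub>F k in sequentially. ?K k z = ?L z"
      proof eventually_elim
        case (elim k)
        then have "2 \<le> snd z / \<epsilon> k" using \<epsilon>(1)[of k] by (simp add: field_simps)
        then show ?case by (simp add: smooth_step_eq_1)
      qed
      then show ?thesis by (rule tendsto_eventually)
    qed simp
    then show "AE z in lebesgue. (\<lambda>k. ?K k z) \<longlonglongrightarrow> ?L z" by simp
  qed
  then have "(\<lambda>k. - integral\<^sup>L lebesgue (?K k)) \<longlonglongrightarrow> - 0" unfolding I0 by (rule tendsto_minus)
  then show "(\<lambda>k. integral\<^sup>L lebesgue (?J k)) \<longlonglongrightarrow> 0" by (simp only: JK minus_zero)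
qed

lemma integrable_ball_indicator: "integrable lebesgue (indicator (ball c r) :: 'a::euclidean_space \<Rightarrow> real)"
  using emeasure_bounded_finite[OF bounded_ball[of c r]]
  by (intro integrable_real_indicator) (auto simp: top.not_eq_extremum)

text \<open>A negative value propagates downwards by monotonicity: \<open>w\<close> stays below a
  negative constant on a column reaching y = 0, so its layer averages there cannot tend to
  0.\<close>

lemma H10_tilde_nonneg:
  fixes w :: "(real ^ 'n) \<times> real \<Rightarrow> real"
  assumes w: "w \<in> H10_tilde" and wc: "continuous_on half_space w"
    and mono: "\<And>x y y'. 0 < y \<Longrightarrow> y \<le> y' \<Longrightarrow> w (x, y) \<le> w (x, y')"
    and z: "z \<in> half_space"
  shows "0 \<le> w z"
proof (rule ccontr)
  assume neg: "\<not> 0 \<le> w z"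
  obtain x1 y1 where xy: "z = (x1, y1)" by (cases z)
  have y1: "0 < y1" using z by (simp add: xy half_space_iff)
  \<comment> \<open>Half of the negative value: as \<open>w z = - 2 * c\<close>, an oscillation
    below \<open>c\<close> still leaves \<open>w < - c\<close> near \<open>z\<close>.\<close>
  define c where "c = - w z / 2"
  have c: "0 < c" using neg by (simp add: c_def)
  obtain d where d: "0 < d" "\<And>p. p \<in> half_space \<Longrightarrow> dist p z < d \<Longrightarrow> dist (w p) (w z) < c"
    using wc z c unfolding continuous_on_iff by blast
  \<comment> \<open>The bound \<open>s \<le> y1\<close> puts the part of the bump above y = 0 below
    the height of \<open>z\<close>, where monotonicity compares with \<open>w (x, y1)\<close>;
    \<open>s \<le> d\<close> keeps (x, y1) inside the neighbourhood of \<open>z\<close>.\<close>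
  define s where "s = min d y1"
  have s: "0 < s" "s \<le> d" "s \<le> y1" using d y1 by (auto simp: s_def)
  define t where "t = s\<^sup>2"
  have t: "0 \<le> t" "sqrt t = s" using s by (auto simp: t_def)
  define a where "a = (x1, 0 :: real)"
  let ?e = "(0, 1) :: (real ^ 'n) \<times> real"
  have wneg: "w p \<le> - c" if "p \<in> half_space" "bump a t p \<noteq> 0" for p
  proof -
    obtain x y where p: "p = (x, y)" by (cases p)
    have y: "0 < y" using that by (simp add: p half_space_iff)
    have "norm (p - a) < s" using bump_eq_0[OF t(1), of p a] that t by force
    then have n: "norm (x - x1) < s" "\<bar>y\<bar> < s"
      using norm_fst_le[of "x - x1" y] norm_snd_le[of y "x - x1"] by (auto simp: p a_def)
    have "dist (x, y1) z = norm (x - x1)" by (simp add: xy dist_norm norm_prod_def)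
    then have "dist (w (x, y1)) (w z) < c" using d(2)[of "(x, y1)"] n s y1 by (simp add: half_space_iff)
    then have "w (x, y1) < - c" by (auto simp: dist_real_def c_def abs_if split: if_splits)
    moreover have "w p \<le> w (x, y1)" using mono[OF y, of y1 x] n s by (simp add: p)
    ultimately show ?thesis by simp
  qed
  define \<epsilon> where "\<epsilon> k = inverse (real (Suc k))" for k
  have \<epsilon>: "0 < \<epsilon> k" "\<epsilon> \<longlonglongrightarrow> 0" for k
    unfolding \<epsilon>_def[abs_def] by (simp, rule LIMSEQ_inverse_real_of_nat)
  define J where "J k = integral\<^sup>L lebesgue (\<lambda>z. indicator half_space z *
           (w z * (hat (snd z / \<epsilon> k) / \<epsilon> k * (bump a t z)\<^sup>2)))" for k
  note lay = H10_tilde_layer_tendsto_0[OF w wc t(1), of \<epsilon>, OF \<epsilon>]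
  \<comment> \<open>On this ball y >= s/4 and the distance to \<open>a\<close> is at most 3s/4, so
    the bump is at least (1 - 9/16) t; this is the origin of 7/16 in
    \<open>\<kappa>\<close>.\<close>
  define b where "b = ball (a + (0, s / 2)) (s / 4)"
  define \<kappa> where "\<kappa> = 4 * (7/16 * t) * (s / 4) * measure lborel b"
  have \<kappa>: "0 < \<kappa>" using s by (simp add: \<kappa>_def b_def t_def)
  have bb: "s / 4 \<le> snd p \<and> 7/16 * t \<le> bump a t p" if "p \<in> b" for p
  proof -
    have n: "norm (p - (a + (0, s / 2))) < s / 4" using that by (simp add: b_def dist_norm norm_minus_commute)
    have "\<bar>snd p - s / 2\<bar> < s / 4"
      using n norm_snd_le[of "snd p - s/2" "fst p - x1"]
      by (cases p) (auto simp: a_def)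
    then have 1: "s / 4 \<le> snd p" by (auto simp: abs_if split: if_splits)
    have "norm (p - a) \<le> norm (p - (a + (0, s / 2))) + norm ((0, s / 2) :: (real ^ 'n) \<times> real)"
      by (metis add_diff_cancel_left' diff_diff_eq diff_add_cancel norm_triangle_ineq)
    also have "\<dots> \<le> 3/4 * s" using n s by (simp add: norm_prod_def)
    finally have "(norm (p - a))\<^sup>2 \<le> (3/4 * s)\<^sup>2" by (intro power_mono) auto
    then have "7/16 * t \<le> t - (norm (p - a))\<^sup>2" by (simp add: t_def power_mult_distrib power_divide)
    then have "7/16 * t \<le> bump a t p" unfolding bump_def by (rule max.coboundedI2)
    then show ?thesis using 1 by blast
  qed
  have upper: "J k \<le> - c * \<kappa>" if k: "2 * \<epsilon> k \<le> s / 4" for k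
  proof -
    let ?s = "\<lambda>z :: (real ^ 'n) \<times> real. smooth_step (snd z / \<epsilon> k)"
    let ?A = "\<lambda>z. hat (snd z / \<epsilon> k) / \<epsilon> k * (bump a t z)\<^sup>2"
    let ?Q = "\<lambda>z. 4 * ?s z * bump a t z * snd z"
    define D where "D z h = hat (snd z / \<epsilon> k) / \<epsilon> k * snd h * (bump a t z)\<^sup>2 +
           smooth_step (snd z / \<epsilon> k) * (- 4 * bump a t z * ((z - a) \<bullet> h))" for z h
    \<comment> \<open>The layer mass is bounded below without iterated integrals: the derivative of
      the cut-off bump integrates to 0, so \<open>?A\<close> and \<open>?Q\<close> have equal
      integrals, and \<open>?Q\<close> is easy to estimate on \<open>b\<close>.\<close>
    have De: "D z ?e = ?A z - ?Q z" for z
      by (simp add: D_def inner_vertical a_def)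
    have der: "((\<lambda>z. ?s z * (bump a t z)\<^sup>2) has_derivative D z) (at z)" for z
      unfolding D_def by (rule C1c_on_half_space_cutoff_bump(2)[OF t(1) \<epsilon>(1)])
    have cA: "continuous_on UNIV ?A"
      by (intro continuous_intros continuous_on_hat continuous_on_bump) (use \<epsilon>(1)[of k] in auto)
    have cQ: "continuous_on UNIV ?Q"
      by (intro continuous_intros continuous_on_smooth_step continuous_on_bump) (use \<epsilon>(1)[of k] in auto)
    have cont: "continuous_on UNIV (\<lambda>z. D z ?e)" unfolding De by (rule continuous_on_diff[OF cA cQ])
    have supp: "?s z * (bump a t z)\<^sup>2 = 0" if "norm a + sqrt t \<le> norm z" for z
      using bump_eq_0_norm[OF t(1) that] by simp
    note D0 = integral_directional_derivative_eq_0[OF der cont supp]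
      integrable_directional_derivative[OF der cont supp]
    have iA: "integrable lebesgue ?A"
    proof -
      obtain C where C: "\<And>z. z \<in> cball 0 (norm a + sqrt t) \<Longrightarrow> \<bar>?A z\<bar> \<le> C"
        using continuous_bounded_on_cball[OF cA] by blast
      have "\<bar>?A z\<bar> \<le> max 0 C" for z
        using C[of z] bump_eq_0_norm[OF t(1), of a z] by (cases "norm z \<le> norm a + sqrt t") auto
      then show ?thesis
        by (rule integrable_lebesgue_bounded_support[OF borel_measurable_lebesgue_continuous[OF cA],
              where a=0 and r="norm a + sqrt t"])
           (use bump_eq_0_norm[OF t(1), of a] in auto)
    qed
    have iQ: "integrable lebesgue ?Q"
    proof -
      have "integrable lebesgue (\<lambda>z. ?A z - D z ?e)" using iA D0(2) by (rule Bochner_Integration.integrable_diff)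
      then show ?thesis by (simp add: De)
    qed
    have AQ: "integral\<^sup>L lebesgue ?A = integral\<^sup>L lebesgue ?Q"
      using D0(1) iA iQ unfolding De by simp
    have "\<kappa> = integral\<^sup>L lebesgue (\<lambda>z. 4 * (7/16 * t) * (s / 4) * indicator b z)"
      by (simp add: \<kappa>_def b_def)
    also have "\<dots> \<le> integral\<^sup>L lebesgue ?Q"
    proof (rule integral_mono[OF _ iQ])
      show "integrable lebesgue (\<lambda>z. 4 * (7/16 * t) * (s / 4) * indicator b z)"
        unfolding b_def by (intro integrable_mult_right integrable_ball_indicator)
      fix z :: "(real ^ 'n) \<times> real"
      show "4 * (7/16 * t) * (s / 4) * indicator b z \<le> ?Q z"
      proof (cases "z \<in> b")
        case True
        note B = bb[OF True]
        have "2 \<le> snd z / \<epsilon> k" using B k \<epsilon>(1)[of k] by (simp add: field_simps)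
        then have "?Q z = 4 * (bump a t z * snd z)" by (simp only: smooth_step_eq_1 mult_1_right mult.assoc)
        moreover have "7/16 * t * (s / 4) \<le> bump a t z * snd z"
          by (intro mult_mono) (use B s t bump_nonneg in auto)
        ultimately show ?thesis using True by (simp only: indicator_simps)
      next
        case False
        have "0 \<le> ?Q z"
        proof (cases "0 \<le> snd z")
          case True then show ?thesis by (simp add: smooth_step_bounds bump_nonneg)
        next
          case False
          then have "snd z / \<epsilon> k \<le> 1" using \<epsilon>(1)[of k] by (simp add: field_simps)
          then show ?thesis by (simp add: smooth_step_eq_0)
        qed
        then show ?thesis using False by simp
      qed
    qed
    finally have low: "\<kappa> \<le> integral\<^sup>L lebesgue ?A" using AQ by simp
    have "J k \<le> integral\<^sup>L lebesgue (\<lambda>z. - c * ?A z)"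
      unfolding J_def
    proof (rule integral_mono)
      show "integrable lebesgue (\<lambda>z. indicator half_space z * (w z * ?A z))" by (rule lay(2))
      show "integrable lebesgue (\<lambda>z. - c * ?A z)" using iA by (rule integrable_mult_right)
      fix p :: "(real ^ 'n) \<times> real"
      have A0: "0 \<le> ?A p" using \<epsilon>(1)[of k] hat_nonneg by simp
      show "indicator half_space p * (w p * ?A p) \<le> - c * ?A p"
      proof (cases "p \<in> half_space \<and> bump a t p \<noteq> 0")
        case True
        then have "w p * ?A p \<le> - c * ?A p" using wneg A0 by (intro mult_right_mono) auto
        then show ?thesis using True by simp
      next
        case False
        then consider "snd p \<le> 0" | "bump a t p = 0" by (auto simp: half_space_iff)
        then have "?A p = 0"
        proof cases
          case 1
          then have "snd p / \<epsilon> k \<le> 0" using \<epsilon>(1)[of k] by (simp add: divide_nonpos_pos)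
          then show ?thesis by (simp add: hat_eq_0)
        qed simp
        then show ?thesis by (simp only: mult_zero_right order_refl)
      qed
    qed
    also have "\<dots> = - c * integral\<^sup>L lebesgue ?A" by simp
    also have "\<dots> \<le> - c * \<kappa>" by (rule mult_left_mono_neg[OF low]) (use c in simp)
    finally show ?thesis .
  qed
  have "\<forall>\<^sub>F k in sequentially. \<epsilon> k < s / 8" using s by (intro order_tendstoD(2)[OF \<epsilon>(2)]) auto
  then have "\<forall>\<^sub>F k in sequentially. J k \<le> - c * \<kappa>"
    by eventually_elim (rule upper, simp)
  moreover have "J \<longlonglongrightarrow> 0" unfolding J_def[abs_def] by (rule lay(1))
  ultimately have "0 \<le> - c * \<kappa>" using tendsto_upperbound by force
  then show False using c \<kappa> by (simp add: mult_le_0_iff)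
qed


section \<open>Subharmonic functions with zero boundary values\<close>

text \<open>The zero extension of \<open>W\<close> is subharmonic across y = 0 when tested against
  P^3. Integrate the divergence of s (P^3 \<nabla>W - W \<nabla>P^3), where s is the step in y /
  \<epsilon>: the interior term is controlled by the sign of \<Delta>W, and of the two layer terms
  one is nonnegative by \<open>inc\<close> while the other is dominated by the vanishing layer
  integral of \<open>W\<close>.\<close>

lemma subharmonic_bump3_nonneg:
  fixes W :: "(real ^ 'n) \<times> real \<Rightarrow> real" and a :: "(real ^ 'n) \<times> real"
  assumes dW: "\<And>z. z \<in> half_space \<Longrightarrow> (W has_derivative W' z) (at z)"
    and ddW: "\<And>z b. z \<in> half_space \<Longrightarrow> b \<in> Basis \<Longrightarrow> ((\<lambda>z. W' z b) has_derivative W'' b z) (at z)"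
    and cW: "\<And>b. b \<in> Basis \<Longrightarrow> continuous_on half_space (\<lambda>z. W'' b z b)"
    and lap: "\<And>z. z \<in> half_space \<Longrightarrow> 0 \<le> (\<Sum>b\<in>Basis. W'' b z b)"
    and inc: "\<And>z. z \<in> half_space \<Longrightarrow> 0 \<le> W' z (0, 1)"
    and bd: "\<And>z. z \<in> half_space \<Longrightarrow> 0 \<le> W z \<and> W z \<le> 1"
    and \<epsilon>: "\<And>k. 0 < \<epsilon> k" "\<epsilon> \<longlonglongrightarrow> 0" and t: "0 \<le> t"
    and layer: "(\<lambda>k. integral\<^sup>L lebesgue (\<lambda>z. indicator half_space z *
           (W z * (hat (snd z / \<epsilon> k) / \<epsilon> k * (bump a t z)\<^sup>2)))) \<longlonglongrightarrow> 0"
    and layer_int: "\<And>k. integrable lebesgue (\<lambda>z. indicator half_space z *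
           (W z * (hat (snd z / \<epsilon> k) / \<epsilon> k * (bump a t z)\<^sup>2)))"
  shows "0 \<le> integral\<^sup>L lebesgue (\<lambda>z. indicator half_space z * W z *
      (24 * bump a t z * (norm (z - a))\<^sup>2 - 6 * real (DIM((real ^ 'n) \<times> real)) * (bump a t z)\<^sup>2))"
    (is "0 \<le> integral\<^sup>L lebesgue (\<lambda>z. indicator ?H z * W z * ?L z)")
proof -
  let ?e = "(0, 1) :: (real ^ 'n) \<times> real"
  let ?s = "\<lambda>k z :: (real ^ 'n) \<times> real. smooth_step (snd z / \<epsilon> k)"
  let ?h = "\<lambda>k z :: (real ^ 'n) \<times> real. hat (snd z / \<epsilon> k) / \<epsilon> k"
  let ?P = "bump a t"
  let ?p1 = "\<lambda>b z. - 6 * (?P z)\<^sup>2 * ((z - a) \<bullet> b)"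
  let ?p2 = "\<lambda>b z h. 24 * ?P z * ((z - a) \<bullet> h) * ((z - a) \<bullet> b) - 6 * (?P z)\<^sup>2 * (h \<bullet> b)"
  let ?J = "\<lambda>k z. indicator ?H z * (W z * (?h k z * (?P z)\<^sup>2))"
  have Wc: "continuous_on ?H W"
    by (intro continuous_at_imp_continuous_on ballI has_derivative_continuous[OF dW])
  have W'c: "continuous_on ?H (\<lambda>z. W' z b)" if "b \<in> Basis" for b
    by (intro continuous_at_imp_continuous_on ballI has_derivative_continuous[OF ddW] that)
  have suppP: "?P z = 0" if "norm a + sqrt t \<le> norm z" for z using bump_eq_0_norm[OF t that] .
  have suppL: "?L z = 0" if "norm a + sqrt t \<le> norm z" for z using suppP[OF that] by simp
  have cL: "continuous_on UNIV ?L" by (intro continuous_intros continuous_on_bump)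
  obtain CL0 where CL0: "\<And>z. z \<in> cball 0 (norm a + sqrt t) \<Longrightarrow> \<bar>?L z\<bar> \<le> CL0"
    using continuous_bounded_on_cball[OF cL] by blast
  define CL where "CL = max 0 CL0"
  have CL: "\<bar>?L z\<bar> \<le> CL" for z
    using CL0[of z] suppL[of z] by (cases "norm z \<le> norm a + sqrt t") (auto simp: CL_def)
  have Hs: "?H \<in> sets borel" by (intro borel_open open_half_space)
  have mW: "(\<lambda>z. indicator ?H z * W z) \<in> borel_measurable lebesgue"
  proof -
    have "(\<lambda>z. indicator ?H z *\<^sub>R W z) \<in> borel_measurable borel"
      by (rule borel_measurable_continuous_on_indicator[OF Hs Wc])
    then show ?thesis by (simp add: measurable_completion)
  qed
  have mL: "?L \<in> borel_measurable lebesgue" by (rule borel_measurable_lebesgue_continuous[OF cL])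
  have W1: "\<bar>indicator ?H z * W z\<bar> \<le> 1" for z using bd[of z] by (auto simp: indicator_def)
  have iWL: "integrable lebesgue (\<lambda>z. indicator ?H z * W z * ?L z)"
  proof (rule integrable_lebesgue_bounded_support[where C=CL and a=0 and r="norm a + sqrt t"])
    show "(\<lambda>z. indicator ?H z * W z * ?L z) \<in> borel_measurable lebesgue"
      using mW mL by (rule borel_measurable_times)
    show "\<bar>indicator ?H z * W z * ?L z\<bar> \<le> CL" for z
      using mult_mono[OF W1 CL, of z z] by (simp add: abs_mult)
  qed (use suppL in auto)
  have sb: "\<bar>?s k z\<bar> \<le> 1" for k z using smooth_step_bounds[of "snd z / \<epsilon> k"] by simp
  have sm: "?s k \<in> borel_measurable lebesgue" for k
    by (intro borel_measurable_lebesgue_continuous continuous_on_smooth_step continuous_intros)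
       (use \<epsilon>(1)[of k] in auto)
  have isWL: "integrable lebesgue (\<lambda>z. indicator ?H z * W z * ?L z * ?s k z)" for k
    by (rule integrable_mult_bounded[OF iWL sm sb])
  have key: "- (6 * sqrt t) * integral\<^sup>L lebesgue (?J k)
      \<le> integral\<^sup>L lebesgue (\<lambda>z. indicator ?H z * W z * ?L z * ?s k z)" for k
  proof -
    \<comment> \<open>The component along \<open>b\<close> of Green's field P^3 \<nabla>W - W
      \<nabla>P^3; \<open>F'\<close> is its derivative, and in the divergence the mixed first-order
      terms cancel.\<close>
    define F where "F b z = ?P z ^ 3 * W' z b - W z * ?p1 b z" for b z
    define F' where "F' b z h = ?P z ^ 3 * W'' b z h + ?p1 h z * W' z b
        - (W z * ?p2 b z h + W' z h * ?p1 b z)" for b z h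
    define D where "D b z h = indicator ?H z * (?h k z * snd h * F b z + ?s k z * F' b z h)" for b z h
    \<comment> \<open>On this set step and tent both vanish, so the cut-off field extends by zero to
      a differentiable field on the whole space.\<close>
    define V where "V = {z :: (real ^ 'n) \<times> real. snd z < \<epsilon> k}"
    have V: "open V" unfolding V_def by (intro open_Collect_less continuous_intros)
    have UN: "?H \<union> V = UNIV" using \<epsilon>(1)[of k] by (auto simp: V_def half_space_iff)
    have V0: "?s k z = 0" "?h k z = 0" if "z \<in> V" for z
    proof -
      have "snd z / \<epsilon> k \<le> 1" using that \<epsilon>(1)[of k] by (simp add: V_def)
      then show "?s k z = 0" "?h k z = 0" by (simp_all add: smooth_step_eq_0 hat_eq_0)
    qed
    have D: "integrable lebesgue (\<lambda>z. D b z b)" "integral\<^sup>L lebesgue (\<lambda>z. D b z b) = 0"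
      if b: "b \<in> Basis" for b
    proof -
      define g where "g z = indicator ?H z * (?s k z * F b z)" for z
      have dH: "(g has_derivative D b z) (at z)" if z: "z \<in> ?H" for z
      proof -
        have dF: "(F b has_derivative F' b z) (at z)"
          unfolding F_def[abs_def] F'_def
          by (rule has_derivative_eq_rhs[OF has_derivative_diff[OF
                has_derivative_mult[OF bump3_has_derivative ddW[OF z b]]
                has_derivative_mult[OF dW[OF z] bump3_second_derivative]]]) (simp add: fun_eq_iff)
        have "((\<lambda>z. ?s k z * F b z) has_derivative D b z) (at z)"
          by (rule has_derivative_eq_rhs[OF has_derivative_mult[OF smooth_step_has_derivative dF]])
             (use z in \<open>simp add: fun_eq_iff D_def\<close>)
        then show ?thesis
          by (rule has_derivative_transform_within_open[OF _ open_half_space z]) (simp add: g_def)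
      qed
      have dV: "(g has_derivative D b z) (at z)" if z: "z \<in> V" for z
      proof -
        have "((\<lambda>_. 0) has_derivative D b z) (at z)"
          by (rule has_derivative_eq_rhs[OF has_derivative_const], rule ext) (simp only: D_def V0[OF z] mult_zero_left mult_zero_right add_0)
        then show ?thesis
          by (rule has_derivative_transform_within_open[OF _ V z]) (simp only: g_def V0 mult_zero_left mult_zero_right)
      qed
      have der: "(g has_derivative D b z) (at z)" for z
        using dH dV UN by blast
      have "continuous_on (?H \<union> V) (\<lambda>z. D b z b)"
      proof (rule continuous_on_open_Un[OF open_half_space V])
        have "continuous_on ?H (\<lambda>z. ?h k z * snd b * F b z + ?s k z * F' b z b)"
          unfolding F_def F'_def using \<epsilon>(1)[of k]
          by (intro continuous_intros continuous_on_bump continuous_on_hat continuous_on_smooth_step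
              Wc W'c cW b) auto
        then show "continuous_on ?H (\<lambda>z. D b z b)"
          by (rule continuous_on_eq) (simp add: D_def)
        show "continuous_on V (\<lambda>z. D b z b)"
          by (rule continuous_on_eq[OF continuous_on_const[of _ 0]]) (simp only: D_def V0 mult_zero_left mult_zero_right add_0)
      qed
      then have cont: "continuous_on UNIV (\<lambda>z. D b z b)" by (simp only: UN)
      have "g z = 0" if "norm a + sqrt t \<le> norm z" for z using suppP[OF that] by (simp add: g_def F_def)
      from integrable_directional_derivative[OF der cont this]
        integral_directional_derivative_eq_0[OF der cont this]
      show "integrable lebesgue (\<lambda>z. D b z b)" "integral\<^sup>L lebesgue (\<lambda>z. D b z b) = 0" by auto
    qed
    have pt: "- (6 * sqrt t) * ?J k z - indicator ?H z * W z * ?L z * ?s k z \<le> (\<Sum>b\<in>Basis. D b z b)" for z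
    proof (cases "z \<in> ?H")
      case True
      have sndb: "(\<Sum>b\<in>Basis. snd b * F b z) = F ?e z"
      proof -
        have "(\<Sum>b\<in>Basis. snd b * F b z) = (\<Sum>b\<in>Basis. if b = ?e then F ?e z else 0)"
          by (rule sum.cong[OF refl]) (auto simp: Basis_prod_def)
        then show ?thesis using vertical_Basis[where 'a="real ^ 'n"] by simp
      qed
      have "(\<Sum>b\<in>Basis. D b z b) = ?h k z * (\<Sum>b\<in>Basis. snd b * F b z) + ?s k z * (\<Sum>b\<in>Basis. F' b z b)"
        using True by (simp add: D_def sum.distrib sum_distrib_left mult.assoc)
      also have "(\<Sum>b\<in>Basis. F' b z b) = ?P z ^ 3 * (\<Sum>b\<in>Basis. W'' b z b) - W z * (\<Sum>b\<in>Basis. ?p2 b z b)"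
      proof -
        have "F' b z b = ?P z ^ 3 * W'' b z b - W z * ?p2 b z b" for b by (simp add: F'_def)
        then have "(\<Sum>b\<in>Basis. F' b z b) = (\<Sum>b\<in>Basis. ?P z ^ 3 * W'' b z b) - (\<Sum>b\<in>Basis. W z * ?p2 b z b)"
          by (simp only: sum_subtractf)
        then show ?thesis by (simp only: sum_distrib_left)
      qed
      finally have eq: "(\<Sum>b\<in>Basis. D b z b) = ?h k z * F ?e z
          + ?s k z * (?P z ^ 3 * (\<Sum>b\<in>Basis. W'' b z b) - W z * ?L z)" by (simp only: sndb bump3_laplacian)
      have h0: "0 \<le> ?h k z" using hat_nonneg \<epsilon>(1)[of k] by simp
      \<comment> \<open>On the support of the bump the height difference to \<open>a\<close> is at
        least \<open>- sqrt t\<close>; the term with \<partial>W/\<partial>y is dropped because it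
        is nonnegative.\<close>
      have "- (6 * sqrt t * (W z * (?P z)\<^sup>2)) \<le> F ?e z"
      proof -
        have "(?P z)\<^sup>2 * - ((z - a) \<bullet> ?e) \<le> (?P z)\<^sup>2 * sqrt t"
        proof (cases "?P z = 0")
          case False
          then have "norm (z - a) \<le> sqrt t" using bump_eq_0[OF t, of z a] by force
          moreover have "\<bar>(z - a) \<bullet> ?e\<bar> \<le> norm (z - a)"
            using Cauchy_Schwarz_ineq2[of "z - a" ?e] by (simp add: norm_prod_def)
          ultimately show ?thesis by (intro mult_left_mono) auto
        qed simp
        then have "W z * ((?P z)\<^sup>2 * - ((z - a) \<bullet> ?e)) \<le> W z * ((?P z)\<^sup>2 * sqrt t)"
          by (rule mult_left_mono) (use bd[OF True] in simp)
        moreover have "0 \<le> ?P z ^ 3 * W' z ?e" using inc[OF True] bump_nonneg[of a t z] by simp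
        ultimately show ?thesis by (simp add: F_def algebra_simps)
      qed
      then have "?h k z * (- (6 * sqrt t * (W z * (?P z)\<^sup>2))) \<le> ?h k z * F ?e z"
        using h0 by (rule mult_left_mono)
      moreover have "0 \<le> ?s k z * (?P z ^ 3 * (\<Sum>b\<in>Basis. W'' b z b))"
        using lap[OF True] bump_nonneg[of a t z] smooth_step_bounds(1) by simp
      ultimately show ?thesis unfolding eq using True by (simp add: algebra_simps)
    qed (simp add: D_def)
    have "integral\<^sup>L lebesgue (\<lambda>z. - (6 * sqrt t) * ?J k z - indicator ?H z * W z * ?L z * ?s k z)
        \<le> integral\<^sup>L lebesgue (\<lambda>z. \<Sum>b\<in>Basis. D b z b)"
      by (rule integral_mono[OF Bochner_Integration.integrable_diff[OF integrable_mult_right[OF layer_int] isWL]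
            Bochner_Integration.integrable_sum[OF D(1)] pt])
    also have "\<dots> = 0" using D by (subst Bochner_Integration.integral_sum) auto
    finally have "integral\<^sup>L lebesgue (\<lambda>z. - (6 * sqrt t) * ?J k z - indicator ?H z * W z * ?L z * ?s k z) \<le> 0" .
    moreover have "integral\<^sup>L lebesgue (\<lambda>z. - (6 * sqrt t) * ?J k z - indicator ?H z * W z * ?L z * ?s k z)
        = integral\<^sup>L lebesgue (\<lambda>z. - (6 * sqrt t) * ?J k z)
          - integral\<^sup>L lebesgue (\<lambda>z. indicator ?H z * W z * ?L z * ?s k z)"
      by (rule Bochner_Integration.integral_diff[OF integrable_mult_right[OF layer_int] isWL])
    moreover have "integral\<^sup>L lebesgue (\<lambda>z. - (6 * sqrt t) * ?J k z) = - (6 * sqrt t) * integral\<^sup>L lebesgue (?J k)"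
      by (rule integral_mult_right_zero)
    ultimately show ?thesis by linarith
  qed
  have "(\<lambda>k. integral\<^sup>L lebesgue (\<lambda>z. indicator ?H z * W z * ?L z * ?s k z)) \<longlonglongrightarrow>
      integral\<^sup>L lebesgue (\<lambda>z. indicator ?H z * W z * ?L z)"
  proof (rule integral_dominated_convergence[where w="\<lambda>z. \<bar>indicator ?H z * W z * ?L z\<bar>"])
    show "(\<lambda>z. indicator ?H z * W z * ?L z) \<in> borel_measurable lebesgue"
      using iWL by (rule borel_measurable_integrable)
    show "(\<lambda>z. indicator ?H z * W z * ?L z * ?s k z) \<in> borel_measurable lebesgue" for k
      using isWL by (rule borel_measurable_integrable)
    show "integrable lebesgue (\<lambda>z. \<bar>indicator ?H z * W z * ?L z\<bar>)" using iWL by (rule integrable_abs)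
    show "AE z in lebesgue. norm (indicator ?H z * W z * ?L z * ?s k z) \<le> \<bar>indicator ?H z * W z * ?L z\<bar>" for k
    proof (rule AE_I2)
      fix z
      show "norm (indicator ?H z * W z * ?L z * ?s k z) \<le> \<bar>indicator ?H z * W z * ?L z\<bar>"
        using mult_left_mono[OF sb[of z k] abs_ge_zero[of "indicator ?H z * W z * ?L z"]]
        unfolding real_norm_def abs_mult mult_1_right by this
    qed
    have "(\<lambda>k. indicator ?H z * W z * ?L z * ?s k z) \<longlonglongrightarrow> indicator ?H z * W z * ?L z" for z
    proof (cases "z \<in> ?H")
      case True
      then have "0 < snd z" by (simp add: half_space_iff)
      then have "\<forall>\<^sub>F k in sequentially. \<epsilon> k < snd z / 2"
        by (intro order_tendstoD(2)[OF \<epsilon>(2)]) auto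
      then have "\<forall>\<^sub>F k in sequentially. indicator ?H z * W z * ?L z * ?s k z = indicator ?H z * W z * ?L z"
      proof eventually_elim
        case (elim k)
        then have "2 \<le> snd z / \<epsilon> k" using \<epsilon>(1)[of k] by (simp add: field_simps)
        then show ?case by (simp only: smooth_step_eq_1 mult_1_right)
      qed
      then show ?thesis by (rule tendsto_eventually)
    qed simp
    then show "AE z in lebesgue. (\<lambda>k. indicator ?H z * W z * ?L z * ?s k z) \<longlonglongrightarrow> indicator ?H z * W z * ?L z"
      by (intro AE_I2)
  qed
  moreover have "(\<lambda>k. - (6 * sqrt t) * integral\<^sup>L lebesgue (?J k)) \<longlonglongrightarrow> - (6 * sqrt t) * 0"
    using layer by (rule tendsto_mult_left)
  ultimately have "- (6 * sqrt t) * 0 \<le> integral\<^sup>L lebesgue (\<lambda>z. indicator ?H z * W z * ?L z)"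
    using key by (intro LIMSEQ_le[rotated]) auto
  then show ?thesis by simp
qed

section \<open>Averages against squared paraboloids and the mean value inequality\<close>

lemma pos_part_square_expansion:
  fixes u v :: real
  shows "\<bar>(max 0 u)\<^sup>2 - (max 0 v)\<^sup>2 - 2 * (u - v) * max 0 v\<bar> \<le> (u - v)\<^sup>2"
proof -
  \<comment> \<open>The first-order Taylor remainder of the squared positive part has constant 1
    even across the kink, since its derivative is 2-Lipschitz.\<close>
  consider "0 \<le> u" "0 \<le> v" | "0 \<le> u" "v < 0" | "u < 0" "0 \<le> v" | "u < 0" "v < 0" by linarith
  then show ?thesis
  proof cases
    case 1
    have "u\<^sup>2 - v\<^sup>2 - 2 * (u - v) * v = (u - v)\<^sup>2" by algebra
    then show ?thesis using 1 by (simp add: max_absorb2)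
  next
    case 2
    then have "u\<^sup>2 \<le> (u - v)\<^sup>2" by (intro power_mono) auto
    then show ?thesis using 2 by (simp add: max_absorb1 max_absorb2)
  next
    case 3
    have "\<bar>- v\<^sup>2 - 2 * (u - v) * v\<bar> = \<bar>v * (v - 2 * u)\<bar>" by (simp add: power2_eq_square algebra_simps)
    also have "\<dots> = v * (v - 2 * u)" using 3 by (intro abs_of_nonneg mult_nonneg_nonneg) auto
    also have "\<dots> \<le> (u - v)\<^sup>2" by (simp add: power2_eq_square algebra_simps)
    finally show ?thesis using 3 by (simp add: max_absorb1 max_absorb2)
  next
    case 4
    then show ?thesis by (simp add: max_absorb1)
  qed
qed

lemma integrable_bounded_mult_bump:
  fixes u :: "'a::euclidean_space \<Rightarrow> real"
  assumes u: "u \<in> borel_measurable lebesgue" "\<And>z. \<bar>u z\<bar> \<le> 1" and t: "0 \<le> t"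
  shows "integrable lebesgue (\<lambda>z. u z * bump a t z)"
    and "integrable lebesgue (\<lambda>z. u z * (bump a t z)\<^sup>2)"
proof -
  have m: "bump a t \<in> borel_measurable lebesgue"
    by (rule borel_measurable_lebesgue_continuous[OF continuous_on_bump])
  have supp: "bump a t z = 0" if "z \<notin> cball 0 (norm a + sqrt t)" for z
    using bump_eq_0_norm[OF t, of a z] that by simp
  have 1: "\<bar>bump a t z\<bar> \<le> t" for z using bump_le[OF t, of a z] bump_nonneg[of a t z] by simp
  have 2: "\<bar>(bump a t z)\<^sup>2\<bar> \<le> t\<^sup>2" for z using power_mono[OF 1, of z 2] by simp
  show "integrable lebesgue (\<lambda>z. u z * bump a t z)"
    by (rule integrable_lebesgue_bounded_support[OF borel_measurable_times[OF u(1) m],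
          where C=t and a=0 and r="norm a + sqrt t"])
       (use mult_mono[OF u(2) 1] supp in \<open>auto simp: abs_mult\<close>)
  show "integrable lebesgue (\<lambda>z. u z * (bump a t z)\<^sup>2)"
    by (rule integrable_lebesgue_bounded_support[OF borel_measurable_times[OF u(1) borel_measurable_power[OF m]],
          where C="t\<^sup>2" and a=0 and r="norm a + sqrt t"])
       (use mult_mono[OF u(2) 2] supp in \<open>auto simp: abs_mult\<close>)
qed

text \<open>Differentiation under the integral sign by a direct estimate: the Taylor remainder is at
  most \<open>h\<^sup>2\<close> pointwise, uniformly in \<open>z\<close>, and is supported in one
  fixed ball. Hence \<open>u\<close> may be any bounded measurable function.\<close>

lemma integral_bump2_deriv:
  fixes u :: "'a::euclidean_space \<Rightarrow> real"
  assumes u: "u \<in> borel_measurable lebesgue" "\<And>z. \<bar>u z\<bar> \<le> 1" and t: "0 < t"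
  shows "((\<lambda>t. integral\<^sup>L lebesgue (\<lambda>z. u z * (bump a t z)\<^sup>2)) has_real_derivative
      2 * integral\<^sup>L lebesgue (\<lambda>z. u z * bump a t z)) (at t)"
proof -
  define B where "B t = integral\<^sup>L lebesgue (\<lambda>z. u z * (bump a t z)\<^sup>2)" for t
  define B1 where "B1 = integral\<^sup>L lebesgue (\<lambda>z. u z * bump a t z)"
  let ?K = "cball 0 (norm a + sqrt (t + 1)) :: 'a set"
  let ?V = "measure lebesgue ?K"
  have iK: "integrable lebesgue (\<lambda>z. c * indicator ?K z :: real)" for c
    using emeasure_bounded_finite[OF bounded_cball[of "0 :: 'a" "norm a + sqrt (t + 1)"]]
    by (intro integrable_mult_right integrable_real_indicator) (auto simp: top.not_eq_extremum)
  \<comment> \<open>The restriction on \<open>h\<close> keeps \<open>t + h\<close> nonnegative and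
    below \<open>t + 1\<close>, so that all bumps involved live in \<open>?K\<close>.\<close>
  have est: "\<bar>B (t + h) - B t - 2 * h * B1\<bar> \<le> h\<^sup>2 * ?V" if h: "\<bar>h\<bar> < min t 1" for h
  proof -
    have th: "0 \<le> t + h" "0 \<le> t" "t + h \<le> t + 1" using h by auto
    let ?E = "\<lambda>z. u z * (bump a (t + h) z)\<^sup>2 - u z * (bump a t z)\<^sup>2 - 2 * h * (u z * bump a t z)"
    note i = integrable_bounded_mult_bump[OF u th(1), of a] integrable_bounded_mult_bump[OF u th(2), of a]
    have iE: "integrable lebesgue ?E"
      using i by (intro Bochner_Integration.integrable_diff integrable_mult_right) auto
    have eq: "B (t + h) - B t - 2 * h * B1 = integral\<^sup>L lebesgue ?E"
      using i by (simp add: B_def B1_def)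
    have "integral\<^sup>L lebesgue (\<lambda>z. \<bar>?E z\<bar>) \<le> integral\<^sup>L lebesgue (\<lambda>z. h\<^sup>2 * indicator ?K z)"
    proof (rule integral_mono[OF integrable_abs[OF iE] iK])
      fix z :: 'a
      show "\<bar>?E z\<bar> \<le> h\<^sup>2 * indicator ?K z"
      proof (cases "z \<in> ?K")
        case True
        have "?E z = u z * ((bump a (t + h) z)\<^sup>2 - (bump a t z)\<^sup>2 - 2 * h * bump a t z)"
          by (simp add: algebra_simps)
        then have "\<bar>?E z\<bar> = \<bar>u z\<bar> * \<bar>(bump a (t + h) z)\<^sup>2 - (bump a t z)\<^sup>2 - 2 * h * bump a t z\<bar>"
          by (simp only: abs_mult)
        also have "\<dots> \<le> 1 * h\<^sup>2"
          using pos_part_square_expansion[of "t + h - (norm (z - a))\<^sup>2" "t - (norm (z - a))\<^sup>2"] u(2)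
          by (intro mult_mono) (auto simp: bump_def)
        finally show ?thesis using True by simp
      next
        case False
        have "sqrt t \<le> sqrt (t + 1)" "sqrt (t + h) \<le> sqrt (t + 1)" using th by auto
        then have "norm a + sqrt t \<le> norm z" "norm a + sqrt (t + h) \<le> norm z"
          using False by (auto simp del: real_sqrt_le_iff)
        then show ?thesis using th by (simp add: bump_eq_0_norm)
      qed
    qed
    also have "\<dots> = h\<^sup>2 * ?V" by simp
    finally have "integral\<^sup>L lebesgue (\<lambda>z. \<bar>?E z\<bar>) \<le> h\<^sup>2 * ?V" .
    with integral_abs_bound[of lebesgue ?E] show ?thesis unfolding eq by (rule order_trans)
  qed
  have "((\<lambda>h. (B (t + h) - B t) / h - 2 * B1) \<longlongrightarrow> 0) (at 0)"
  proof (rule Lim_null_comparison[where g="\<lambda>h. \<bar>h\<bar> * ?V"])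
    have "norm ((B (t + h) - B t) / h - 2 * B1) \<le> \<bar>h\<bar> * ?V" if "\<bar>h\<bar> < min t 1" "h \<noteq> 0" for h
    proof -
      have "(B (t + h) - B t) / h - 2 * B1 = (B (t + h) - B t - 2 * h * B1) / h"
        using that by (simp add: field_simps)
      then have "norm ((B (t + h) - B t) / h - 2 * B1) = \<bar>B (t + h) - B t - 2 * h * B1\<bar> / \<bar>h\<bar>" by simp
      also have "\<dots> \<le> h\<^sup>2 * ?V / \<bar>h\<bar>" by (intro divide_right_mono est that) auto
      also have "\<dots> = \<bar>h\<bar> * ?V" using that by (simp add: power2_eq_square field_simps abs_if)
      finally show ?thesis .
    qed
    then show "\<forall>\<^sub>F h in at 0. norm ((B (t + h) - B t) / h - 2 * B1) \<le> \<bar>h\<bar> * ?V"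
      unfolding eventually_at using t by (intro exI[of _ "min t 1"]) (auto simp: dist_real_def)
    have "((\<lambda>h. \<bar>h\<bar> * ?V) \<longlongrightarrow> \<bar>0\<bar> * ?V) (at 0)" by (intro tendsto_intros)
    then show "((\<lambda>h. \<bar>h\<bar> * ?V) \<longlongrightarrow> 0) (at 0)" by simp
  qed
  then have "((\<lambda>h. (B (t + h) - B t) / h) \<longlongrightarrow> 2 * B1) (at 0)" by (rule LIM_zero_cancel)
  then have "(B has_real_derivative 2 * B1) (at t)" by (simp add: DERIV_def)
  then show ?thesis by (simp add: B_def[abs_def] B1_def)
qed

text \<open>On the support the squared distance is \<open>t - bump a t z\<close>. Eliminating it
  leaves only P and P^2, the two quantities linked by differentiation in \<open>t\<close>.\<close>

lemma bump_laplacian_eq: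
  "24 * bump a t z * (norm (z - a))\<^sup>2 - 6 * N * (bump a t z)\<^sup>2
     = 24 * t * bump a t z - (24 + 6 * N) * (bump a t z)\<^sup>2"
proof (cases "bump a t z = 0")
  case False
  then have "(norm (z - a))\<^sup>2 = t - bump a t z" by (auto simp: bump_def max_def split: if_splits)
  show ?thesis unfolding \<open>(norm (z - a))\<^sup>2 = t - bump a t z\<close> by algebra
qed simp

text \<open>The case of the constant function 1, where subharmonicity holds with equality; it
  normalises the averages.\<close>

lemma integral_laplacian_bump3:
  fixes a :: "'a::euclidean_space"
  assumes t: "0 \<le> t"
  shows "integral\<^sup>L lebesgue (\<lambda>z. 24 * bump a t z * (norm (z - a))\<^sup>2 - 6 * real DIM('a) * (bump a t z)\<^sup>2) = 0"
proof -
  let ?P = "bump a t"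
  let ?p2 = "\<lambda>b z h. 24 * ?P z * ((z - a) \<bullet> h) * ((z - a) \<bullet> b) - 6 * (?P z)\<^sup>2 * (h \<bullet> b)"
  have c: "continuous_on UNIV (\<lambda>z. ?p2 b z b)" for b
    by (intro continuous_intros continuous_on_bump)
  have s: "- 6 * (?P z)\<^sup>2 * ((z - a) \<bullet> b) = 0" if "norm a + sqrt t \<le> norm z" for b z
    using bump_eq_0_norm[OF t that] by simp
  have "integrable lebesgue (\<lambda>z. ?p2 b z b)" "integral\<^sup>L lebesgue (\<lambda>z. ?p2 b z b) = 0" for b
    by (rule integrable_directional_derivative[OF bump3_second_derivative c s[where b=b]], assumption,
        rule integral_directional_derivative_eq_0[OF bump3_second_derivative c s[where b=b]], assumption)
  then have "integral\<^sup>L lebesgue (\<lambda>z. \<Sum>b\<in>Basis. ?p2 b z b) = 0"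
    by (simp only: Bochner_Integration.integral_sum sum.neutral_const)
  then show ?thesis by (simp only: bump3_laplacian)
qed

text \<open>The mean value inequality.  For \<open>P = bump a t\<close> in dimension \<open>N\<close> one has
  \<open>\<partial>\<^sub>t P\<^sup>2 = 2 P\<close> and \<open>\<Delta> P\<^sup>3 = 24 t P - (24 + 6 N) P\<^sup>2\<close>, so the weak subharmonicity of \<open>u\<close>, tested with
  \<open>P\<^sup>3\<close>, says that the average of \<open>u\<close> against \<open>P\<^sup>2\<close> is nondecreasing in \<open>t\<close>.\<close>

lemma half_space_subharmonic_contraction:
  fixes W :: "(real ^ 'n) \<times> real \<Rightarrow> real"
  assumes Wc: "continuous_on half_space W"
    and sub: "\<And>a t. 0 < t \<Longrightarrow> 0 \<le> integral\<^sup>L lebesgue (\<lambda>z. indicator half_space z * W z *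
      (24 * bump a t z * (norm (z - a))\<^sup>2 - 6 * real (DIM((real ^ 'n) \<times> real)) * (bump a t z)\<^sup>2))"
    and bd: "\<And>z. z \<in> half_space \<Longrightarrow> 0 \<le> W z \<and> W z \<le> M" and M: "M \<le> 1"
    and a: "a \<in> half_space"
  shows "W a \<le> (1 - (49/256) / 4 ^ DIM((real ^ 'n) \<times> real)) * M"
proof -
  let ?H = "half_space :: ((real ^ 'n) \<times> real) set"
  let ?N = "DIM((real ^ 'n) \<times> real)"
  define \<alpha> where "\<alpha> = 24 + 6 * real ?N"
  define u where "u z = indicator ?H z * W z" for z
  define y where "y = snd a"
  have y: "0 < y" using a by (simp add: y_def half_space_iff)
  have M0: "0 \<le> M" using bd[OF a] by simp
  have u: "u \<in> borel_measurable lebesgue" "\<bar>u z\<bar> \<le> 1" for z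
  proof -
    have "(\<lambda>z. indicator ?H z *\<^sub>R W z) \<in> borel_measurable borel"
      by (intro borel_measurable_continuous_on_indicator[OF _ Wc] borel_open open_half_space)
    then show "u \<in> borel_measurable lebesgue" by (simp add: measurable_completion u_def[abs_def])
    show "\<bar>u z\<bar> \<le> 1" using bd[of z] M by (auto simp: indicator_def u_def)
  qed
  have one: "(\<lambda>z :: (real ^ 'n) \<times> real. 1 :: real) \<in> borel_measurable lebesgue"
    "\<And>z :: (real ^ 'n) \<times> real. \<bar>1 :: real\<bar> \<le> 1" by auto
  define B where "B t = integral\<^sup>L lebesgue (\<lambda>z. u z * (bump a t z)\<^sup>2)" for t
  define B1 where "B1 t = integral\<^sup>L lebesgue (\<lambda>z. u z * bump a t z)" for t
  define C where "C t = integral\<^sup>L lebesgue (\<lambda>z. 1 * (bump a t z)\<^sup>2)" for t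
  define C1 where "C1 t = integral\<^sup>L lebesgue (\<lambda>z. 1 * bump a t z)" for t
  note iu = integrable_bounded_mult_bump[OF u less_imp_le]
  note i1 = integrable_bounded_mult_bump[OF one less_imp_le]
  have dB: "(B has_real_derivative 2 * B1 t) (at t)" if "0 < t" for t
    unfolding B_def[abs_def] B1_def by (rule integral_bump2_deriv[OF u that])
  have dC: "(C has_real_derivative 2 * C1 t) (at t)" if "0 < t" for t
    unfolding C_def[abs_def] C1_def by (rule integral_bump2_deriv[OF one that])
  \<comment> \<open>\<open>B\<close> satisfies a differential inequality and \<open>C\<close> the
    same relation as an equality; comparing them gives the sign of the derivative of
    \<open>B / C\<close>.\<close>
  have B1: "\<alpha> * B t \<le> 24 * t * B1 t" if t: "0 < t" for t
  proof -
    have "0 \<le> integral\<^sup>L lebesgue (\<lambda>z. u z * (24 * t * bump a t z - \<alpha> * (bump a t z)\<^sup>2))"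
      using sub[OF t, of a] unfolding bump_laplacian_eq \<alpha>_def u_def .
    also have "\<dots> = integral\<^sup>L lebesgue (\<lambda>z. 24 * t * (u z * bump a t z) - \<alpha> * (u z * (bump a t z)\<^sup>2))"
      by (simp add: algebra_simps)
    also have "\<dots> = 24 * t * B1 t - \<alpha> * B t"
      unfolding B1_def B_def using iu[OF t, of a]
      by (subst Bochner_Integration.integral_diff) auto
    finally show ?thesis by simp
  qed
  have C1: "\<alpha> * C t = 24 * t * C1 t" if t: "0 < t" for t
  proof -
    have "0 = integral\<^sup>L lebesgue (\<lambda>z. 24 * t * bump a t z - \<alpha> * (bump a t z)\<^sup>2)"
      using integral_laplacian_bump3[of t a] t unfolding bump_laplacian_eq \<alpha>_def by simp
    also have "\<dots> = 24 * t * C1 t - \<alpha> * C t"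
      unfolding C1_def C_def using i1[OF t, of a]
      by (subst Bochner_Integration.integral_diff) auto
    finally show ?thesis by simp
  qed
  have Cpos: "0 < C t" if t: "0 < t" for t
  proof -
    have "0 < (3/4 * t)\<^sup>2 * measure lborel (ball a (sqrt t / 2))" using t by simp
    also have "\<dots> = integral\<^sup>L lebesgue (\<lambda>z. (3/4 * t)\<^sup>2 * indicator (ball a (sqrt t / 2)) z)" by simp
    also have "\<dots> \<le> C t"
      unfolding C_def
    proof (rule integral_mono[OF integrable_mult_right[OF integrable_ball_indicator] i1(2)[OF t]])
      fix z
      show "(3/4 * t)\<^sup>2 * indicator (ball a (sqrt t / 2)) z \<le> 1 * (bump a t z)\<^sup>2"
      proof (cases "z \<in> ball a (sqrt t / 2)")
        case True
        then have "norm (z - a) \<le> sqrt t / 2" by (simp add: dist_norm norm_minus_commute)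
        then have "(norm (z - a))\<^sup>2 \<le> (sqrt t / 2)\<^sup>2" by (intro power_mono) auto
        then have "3/4 * t \<le> t - (norm (z - a))\<^sup>2" using t by (simp add: power_divide)
        then have "3/4 * t \<le> bump a t z" unfolding bump_def by (rule max.coboundedI2)
        then have "(3/4 * t)\<^sup>2 \<le> (bump a t z)\<^sup>2" using t by (intro power_mono) auto
        then show ?thesis using True by simp
      qed simp
    qed
    finally show ?thesis .
  qed
  define Q where "Q t = B t / C t" for t
  have Qmono: "Q s \<le> Q t" if "0 < s" "s \<le> t" for s t
  proof (rule DERIV_nonneg_imp_nondecreasing[OF that(2)])
    fix x assume "s \<le> x" "x \<le> t"
    then have x: "0 < x" using that by simp
    let ?D = "(2 * B1 x * C x - B x * (2 * C1 x)) / (C x * C x)"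
    have "(Q has_real_derivative ?D) (at x)"
      unfolding Q_def[abs_def] using Cpos[OF x] by (intro DERIV_divide dB dC x) auto
    moreover have "0 \<le> ?D"
    proof -
      have "24 * x * (B x * C1 x) = B x * (\<alpha> * C x)" using C1[OF x] by simp
      also have "\<dots> = \<alpha> * B x * C x" by simp
      also have "\<dots> \<le> 24 * x * B1 x * C x" using B1[OF x] Cpos[OF x] by (intro mult_right_mono) auto
      finally have "24 * x * (B x * C1 x) \<le> 24 * x * (B1 x * C x)" by (simp add: mult.assoc)
      then have "B x * C1 x \<le> B1 x * C x" using x by simp
      then show ?thesis by (intro divide_nonneg_nonneg) auto
    qed
    ultimately show "\<exists>D. (Q has_real_derivative D) (at x) \<and> 0 \<le> D" by blast
  qed
  \<comment> \<open>The bump with this parameter has radius 4y around \<open>a\<close>. The ball of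
    radius y about the point \<open>p\<close>, at height -y, lies strictly below the boundary and
    within distance 3y of \<open>a\<close>, so there the bump is at least 16 y^2 - 9 y^2 = 7 y^2
    while \<open>u\<close> is 0.\<close>
  define T where "T = 16 * y\<^sup>2"
  have T: "0 < T" "sqrt T = 4 * y" using y by (auto simp: T_def real_sqrt_mult)
  define p where "p = a - (0, 2 * y)"
  define v where "v = measure lborel (ball p y)"
  have pb: "snd z < 0 \<and> 7 * y\<^sup>2 \<le> bump a T z" if "z \<in> ball p y" for z
  proof -
    have n: "norm (z - p) < y" using that by (simp add: dist_norm norm_minus_commute)
    have "\<bar>snd z + y\<bar> < y" using n norm_snd_le[of "snd z - snd p" "fst z - fst p"]
      by (cases z; cases a) (auto simp: p_def y_def algebra_simps)
    then have 1: "snd z < 0" by (auto simp: abs_if split: if_splits)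
    have "norm (z - a) \<le> norm (z - p) + norm (p - a)" by (metis diff_add_cancel add_diff_eq norm_triangle_ineq)
    also have "p - a = - (0, 2 * y)" by (simp add: p_def)
    also have "norm (- (0, 2 * y) :: (real ^ 'n) \<times> real) = 2 * y" 
      using y by (subst norm_minus_cancel) simp
    finally have "norm (z - a) \<le> 3 * y" using n by simp
    then have "(norm (z - a))\<^sup>2 \<le> (3 * y)\<^sup>2" by (intro power_mono) auto
    then have "7 * y\<^sup>2 \<le> T - (norm (z - a))\<^sup>2" by (simp add: T_def power_mult_distrib)
    then have "7 * y\<^sup>2 \<le> bump a T z" unfolding bump_def by (rule max.coboundedI2)
    with 1 show ?thesis by blast
  qed
  have CT: "C T \<le> T\<^sup>2 * (4 ^ ?N * v)"
  proof -
    have "C T \<le> integral\<^sup>L lebesgue (\<lambda>z. T\<^sup>2 * indicator (ball a (4 * y)) z)"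
      unfolding C_def
    proof (rule integral_mono[OF i1(2)[OF T(1)] integrable_mult_right[OF integrable_ball_indicator]])
      fix z
      show "1 * (bump a T z)\<^sup>2 \<le> T\<^sup>2 * indicator (ball a (4 * y)) z"
      proof (cases "z \<in> ball a (4 * y)")
        case True
        have "(bump a T z)\<^sup>2 \<le> T\<^sup>2" using T by (intro power_mono bump_le bump_nonneg) auto
        then show ?thesis using True by simp
      next
        case False
        then have "sqrt T \<le> norm (z - a)" using T by (simp add: dist_norm norm_minus_commute)
        then show ?thesis using bump_eq_0[of T z a] T False by simp
      qed
    qed
    also have "\<dots> = T\<^sup>2 * measure lborel (ball a (4 * y))" by simp
    also have "measure lborel (ball a (4 * y)) = 4 ^ ?N * v"
      unfolding v_def using y by (simp add: content_ball power_mult_distrib del: DIM_prod DIM_cart)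
    finally show ?thesis .
  qed
  have BT: "B T \<le> M * (C T - (7 * y\<^sup>2)\<^sup>2 * v)"
  proof -
    have "B T \<le> integral\<^sup>L lebesgue (\<lambda>z. M * (1 * (bump a T z)\<^sup>2 - (7 * y\<^sup>2)\<^sup>2 * indicator (ball p y) z))"
      unfolding B_def
    proof (rule integral_mono[OF iu(2)[OF T(1)] integrable_mult_right[OF
            Bochner_Integration.integrable_diff[OF i1(2)[OF T(1)] integrable_mult_right[OF integrable_ball_indicator]]]])
      fix z
      show "u z * (bump a T z)\<^sup>2 \<le> M * (1 * (bump a T z)\<^sup>2 - (7 * y\<^sup>2)\<^sup>2 * indicator (ball p y) z)"
      proof (cases "z \<in> ball p y")
        case True
        then have "u z = 0" using pb[OF True] by (simp add: u_def half_space_def)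
        moreover have "(7 * y\<^sup>2)\<^sup>2 \<le> (bump a T z)\<^sup>2" using pb[OF True] by (intro power_mono) auto
        ultimately show ?thesis using True M0 by simp
      next
        case False
        have "u z \<le> M" using bd[of z] M0 by (auto simp: u_def indicator_def)
        then show ?thesis using False by (simp add: mult_right_mono)
      qed
    qed
    also have "\<dots> = M * (C T - (7 * y\<^sup>2)\<^sup>2 * v)"
      unfolding C_def v_def using i1(2)[OF T(1), of a]
      by (simp add: Bochner_Integration.integral_diff[OF _ integrable_mult_right[OF integrable_ball_indicator]])
    finally show ?thesis .
  qed
  \<comment> \<open>The lost fraction is (7 y^2)^2 / (16 y^2)^2 = 49/256 from the weights, times the
    volume ratio 1 / 4^N of the balls of radii y and 4y. It is independent of y.\<close>
  have QT: "Q T \<le> (1 - (49/256) / 4 ^ ?N) * M"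
  proof -
    have "(49/256) / 4 ^ ?N * C T \<le> (49/256) / 4 ^ ?N * (T\<^sup>2 * (4 ^ ?N * v))"
      using CT by (intro mult_left_mono) auto
    also have "\<dots> = (7 * y\<^sup>2)\<^sup>2 * v" by (simp add: T_def power2_eq_square del: DIM_prod DIM_cart)
    finally have "M * (C T - (7 * y\<^sup>2)\<^sup>2 * v) \<le> M * (C T - (49/256) / 4 ^ ?N * C T)"
      using M0 by (intro mult_left_mono) auto
    then have "B T \<le> (1 - (49/256) / 4 ^ ?N) * M * C T" using BT by (simp add: algebra_simps)
    then show ?thesis unfolding Q_def using Cpos[OF T(1)] by (simp add: pos_divide_le_eq del: DIM_prod DIM_cart)
  qed
  \<comment> \<open>By continuity the averages at small scale recover \<open>W a\<close> up to
    \<open>\<eta>\<close>; \<open>d \<le> y\<close> keeps the small ball inside the half-space and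
    its parameter below \<open>T\<close>.\<close>
  have approx: "W a - \<eta> \<le> (1 - (49/256) / 4 ^ ?N) * M" if \<eta>: "0 < \<eta>" for \<eta>
  proof -
    obtain d1 where d1: "0 < d1" "\<And>z. z \<in> ?H \<Longrightarrow> dist z a < d1 \<Longrightarrow> dist (W z) (W a) < \<eta>"
      using Wc a \<eta> unfolding continuous_on_iff by blast
    define d where "d = min d1 y"
    have d: "0 < d" "d \<le> d1" "d \<le> y" using d1 y by (auto simp: d_def)
    define s where "s = d\<^sup>2"
    have s: "0 < s" "sqrt s = d" using d by (auto simp: s_def)
    have "d\<^sup>2 \<le> y\<^sup>2" using d by (intro power_mono) auto
    moreover have "0 \<le> y\<^sup>2" by simp
    ultimately have sT: "s \<le> T" unfolding s_def T_def by linarith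
    have "integral\<^sup>L lebesgue (\<lambda>z. (W a - \<eta>) * (1 * (bump a s z)\<^sup>2)) \<le> B s"
      unfolding B_def
    proof (rule integral_mono[OF integrable_mult_right[OF i1(2)[OF s(1)]] iu(2)[OF s(1)]])
      fix z
      show "(W a - \<eta>) * (1 * (bump a s z)\<^sup>2) \<le> u z * (bump a s z)\<^sup>2"
      proof (cases "bump a s z = 0")
        case False
        then have n: "norm (z - a) < d" using bump_eq_0[of s z a] s by force
        have "\<bar>snd z - y\<bar> < d" using n norm_snd_le[of "snd z - snd a" "fst z - fst a"]
          by (cases z; cases a) (auto simp: y_def)
        then have zH: "z \<in> ?H" using d by (auto simp: half_space_iff abs_if split: if_splits)
        then have "dist (W z) (W a) < \<eta>" using d1(2)[OF zH] n d by (simp add: dist_norm)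
        then have "W a - \<eta> \<le> u z" using zH by (auto simp: u_def dist_real_def abs_if split: if_splits)
        then have "(W a - \<eta>) * (bump a s z)\<^sup>2 \<le> u z * (bump a s z)\<^sup>2" by (rule mult_right_mono) simp
        then show ?thesis by simp
      qed simp
    qed
    moreover have "integral\<^sup>L lebesgue (\<lambda>z. (W a - \<eta>) * (1 * (bump a s z)\<^sup>2)) = (W a - \<eta>) * C s"
      unfolding C_def by (rule integral_mult_right_zero)
    ultimately have "(W a - \<eta>) * C s \<le> B s" by linarith
    then have "W a - \<eta> \<le> Q s" using Cpos[OF s(1)] by (simp add: Q_def pos_le_divide_eq)
    also have "\<dots> \<le> Q T" by (rule Qmono[OF s(1) sT])
    finally show ?thesis using QT by simp
  qed
  show ?thesis
  proof (rule field_le_epsilon)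
    fix \<eta> :: real assume "0 < \<eta>"
    from approx[OF this] show "W a \<le> (1 - (49/256) / 4 ^ ?N) * M + \<eta>" by (simp only: diff_le_eq)
  qed
qed

text \<open>The contraction applies at every point with one factor below 1, so any upper bound
  \<open>M\<close> improves to that factor times \<open>M\<close>; iterating from the bound 1 drives
  it to 0.\<close>

lemma half_space_subharmonic_eq_0:
  fixes W :: "(real ^ 'n) \<times> real \<Rightarrow> real"
  assumes Wc: "continuous_on half_space W"
    and sub: "\<And>a t. 0 < t \<Longrightarrow> 0 \<le> integral\<^sup>L lebesgue (\<lambda>z. indicator half_space z * W z *
      (24 * bump a t z * (norm (z - a))\<^sup>2 - 6 * real (DIM((real ^ 'n) \<times> real)) * (bump a t z)\<^sup>2))"
    and bd: "\<And>z. z \<in> half_space \<Longrightarrow> 0 \<le> W z \<and> W z \<le> 1"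
    and z: "z \<in> half_space"
  shows "W z = 0"
proof -
  let ?c = "(49/256) / 4 ^ DIM((real ^ 'n) \<times> real) :: real"
  have "1 \<le> (4 :: real) ^ DIM((real ^ 'n) \<times> real)" by (rule one_le_power) simp
  then have "?c \<le> 1" by (subst pos_divide_le_eq) linarith+
  then have c: "0 \<le> 1 - ?c" "1 - ?c < 1" by (simp_all del: DIM_prod DIM_cart)
  have "\<forall>z\<in>half_space. W z \<le> (1 - ?c) ^ k" for k
  proof (induction k)
    case 0
    then show ?case using bd by simp
  next
    case (Suc k)
    have "0 \<le> W z \<and> W z \<le> (1 - ?c) ^ k" if "z \<in> half_space" for z using bd that Suc by blast
    moreover have "(1 - ?c) ^ k \<le> 1" using c by (intro power_le_one) auto
    ultimately have "W z \<le> (1 - ?c) * (1 - ?c) ^ k" if "z \<in> half_space" for z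
      by (intro half_space_subharmonic_contraction[OF Wc sub _ _ that])
    then show ?case by simp
  qed
  then have "W z \<le> (1 - ?c) ^ k" for k using z by blast
  moreover have "(\<lambda>k. (1 - ?c) ^ k) \<longlonglongrightarrow> 0" using c by (intro LIMSEQ_realpow_zero) auto
  ultimately have "W z \<le> 0" by (intro LIMSEQ_le_const) auto
  then show ?thesis using bd[OF z] by simp
qed


section \<open>Rigidity\<close>

text \<open>On the slab between heights \<delta> and 2 \<delta> positivity forces w <= 1 - 1 / (2
  \<delta>) <= - 1 / (4 \<delta>). The slab has volume m \<delta>, so the squared integral is at
  least m / (16 \<delta>), unbounded as \<delta> tends to 0.\<close>

lemma H10_tilde_not_positive:
  fixes v :: "(real ^ 'n) \<times> real \<Rightarrow> real"
  assumes w: "w_fun v \<in> H10_tilde"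
  shows "\<not> (\<forall>z\<in>half_space. 0 < v z)"
proof
  assume pos: "\<forall>z\<in>half_space. 0 < v z"
  let ?B = "half_ball 1 :: ((real ^ 'n) \<times> real) set"
  let ?N = "DIM((real ^ 'n) \<times> real)"
  obtain G :: "(real ^ 'n) \<times> real \<Rightarrow> (real ^ 'n) \<times> real" where
    fin: "(\<integral>\<^sup>+z\<in>?B. ennreal ((norm (G z))\<^sup>2 + (w_fun v z)\<^sup>2) \<partial>lebesgue) < \<infinity>"
    using w zero_less_one unfolding H10_tilde_def by blast
  define I where "I = (\<integral>\<^sup>+z\<in>?B. ennreal ((norm (G z))\<^sup>2 + (w_fun v z)\<^sup>2) \<partial>lebesgue)"
  define m where "m = measure lborel (ball (0 :: real ^ 'n) (1/2))"
  have m: "0 < m" "emeasure lborel (ball (0 :: real ^ 'n) (1/2)) = ennreal m"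
    using emeasure_bounded_finite[OF bounded_ball[of "0 :: real ^ 'n" "1/2"]]
    by (auto simp: m_def emeasure_eq_ennreal_measure less_top)
  have low: "ennreal (m / (16 * \<delta>)) \<le> I" if \<delta>: "0 < \<delta>" "\<delta> \<le> 1/4" for \<delta>
  proof -
    define Q where "Q = ball (0 :: real ^ 'n) (1/2) \<times> {\<delta><..<2 * \<delta>}"
    have Qo: "open Q" unfolding Q_def by (intro open_Times) auto
    have "ennreal (m / (16 * \<delta>)) = ennreal (1 / (16 * \<delta>\<^sup>2)) * (ennreal m * ennreal \<delta>)"
      using \<delta> m by (simp add: ennreal_mult[symmetric] power2_eq_square field_simps)
    also have "ennreal m * ennreal \<delta> = emeasure lborel Q"
      unfolding Q_def lborel_prod[symmetric] using \<delta>
      by (subst lborel.emeasure_pair_measure_Times) (auto simp: m)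
    also have "ennreal (1 / (16 * \<delta>\<^sup>2)) * emeasure lborel Q
        = (\<integral>\<^sup>+z. ennreal (1 / (16 * \<delta>\<^sup>2)) * indicator Q z \<partial>lebesgue)"
      using Qo by (subst nn_integral_cmult_indicator) auto
    also have "\<dots> \<le> I"
      unfolding I_def
    proof (rule nn_integral_mono)
      fix z :: "(real ^ 'n) \<times> real"
      show "ennreal (1 / (16 * \<delta>\<^sup>2)) * indicator Q z
          \<le> ennreal ((norm (G z))\<^sup>2 + (w_fun v z)\<^sup>2) * indicator ?B z"
      proof (cases "z \<in> Q")
        case True
        then obtain x s where z: "z = (x, s)" "norm x < 1/2" "\<delta> < s" "s < 2 * \<delta>"
          by (auto simp: Q_def)
        have "norm z \<le> norm x + norm s" unfolding z(1) by (rule norm_Pair_le)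
        then have zB: "z \<in> ?B" using z \<delta> by (simp add: half_ball_iff)
        then have "0 < v z" using pos by (simp add: half_ball_iff half_space_iff)
        then have "1 / s \<le> exp (v z) / s" using z \<delta> by (intro divide_right_mono) auto
        moreover have "1 / (2 * \<delta>) \<le> 1 / s" using z \<delta> by (intro divide_left_mono) auto
        moreover have "1 \<le> 1 / (4 * \<delta>)" using \<delta> by (simp add: field_simps)
        moreover have "1 / (2 * \<delta>) = 1 / (4 * \<delta>) + 1 / (4 * \<delta>)" by simp
        ultimately have "1 / (4 * \<delta>) \<le> - w_fun v z" unfolding w_fun_def z(1) snd_conv by linarith
        then have "(1 / (4 * \<delta>))\<^sup>2 \<le> (- w_fun v z)\<^sup>2" using \<delta> by (intro power_mono) auto
        then have "1 / (16 * \<delta>\<^sup>2) \<le> (norm (G z))\<^sup>2 + (w_fun v z)\<^sup>2"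
          by (simp add: power_divide power_mult_distrib add_increasing)
        then show ?thesis using True zB by (simp only: indicator_simps mult_1_right ennreal_leI)
      qed simp
    qed
    finally show ?thesis .
  qed
  obtain r where r: "0 \<le> r" "I = ennreal r" using fin unfolding I_def[symmetric] by (cases I) auto
  \<comment> \<open>Chosen so that m / (16 \<delta>) is at least \<open>r + 1\<close>, beyond the
    finite value \<open>r\<close> of the integral.\<close>
  define \<delta> where "\<delta> = min (1/4) (m / (16 * (r + 1)))"
  have \<delta>: "0 < \<delta>" "\<delta> \<le> 1/4" using m r unfolding \<delta>_def by (simp, intro min.cobounded1)
  have "\<delta> \<le> m / (16 * (r + 1))" by (simp add: \<delta>_def)
  then have "r + 1 \<le> m / (16 * \<delta>)" using \<delta> r by (simp add: field_simps)
  moreover have "m / (16 * \<delta>) \<le> r" using low[OF \<delta>] r by simp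
  ultimately show False by simp
qed

theorem corollary5p10:
  fixes v :: "(real ^ 'n) \<times> real \<Rightarrow> real"
  assumes regular: "Ck_on 2 half_space v"
    and pde: "\<forall>z\<in>half_space. - laplace_beltrami g_plus v z - real CARD('n) = 0"
    and positive: "CARD('n) = 1 \<Longrightarrow> \<forall>z\<in>half_space. 0 < v z"
    and sobolev: "w_fun v \<in> H10_tilde"
    and curvature: "\<forall>z\<in>half_space. 0 \<le> scalar_curvature (g_star v) z"
  shows "(\<forall>z\<in>half_space. w_fun v z = 0) \<and>
         (\<forall>z\<in>half_space. \<forall>a b. g_star v z a b = a \<bullet> b)"
proof -
  let ?H = "half_space :: ((real ^ 'n) \<times> real) set"
  let ?e = "(0, 1) :: (real ^ 'n) \<times> real"
  let ?n = "real CARD('n)"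
  have H: "open ?H" by (rule open_half_space)
  have y: "0 < snd z" if "z \<in> ?H" for z using that by (simp add: half_space_iff)

  \<comment> \<open>Gradient and Hessian of \<open>v\<close> from its partial derivatives\<close>
  define X where "X = gradient v"
  define vb where "vb b z = frechet_derivative v (at z) b" for b z
  have dv: "v differentiable (at z)" if "z \<in> ?H" for z
    using regular that by (simp add: numeral_2_eq_2)
  have dvb: "vb b differentiable (at z)" if "z \<in> ?H" "b \<in> Basis" for z b
    using regular that by (simp add: numeral_2_eq_2 vb_def[abs_def])
  have cvb: "continuous_on ?H (\<lambda>z. frechet_derivative (vb b) (at z) c)" if "b \<in> Basis" "c \<in> Basis" for b c
    using regular that by (simp add: numeral_2_eq_2 vb_def[abs_def])
  have Xb: "X z \<bullet> b = vb b z" if "b \<in> Basis" for z b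
    using that by (simp add: X_def gradient_def vb_def inner_sum_left inner_Basis if_distrib[of "\<lambda>x. _ * x"] cong: if_cong)
  have v': "(v has_derivative (\<lambda>h. X z \<bullet> h)) (at z)" if "z \<in> ?H" for z
  proof -
    have d: "(v has_derivative frechet_derivative v (at z)) (at z)"
      using dv[OF that] by (simp add: frechet_derivative_works)
    have "frechet_derivative v (at z) h = X z \<bullet> h" for h
    proof -
      have "frechet_derivative v (at z) h = frechet_derivative v (at z) (\<Sum>b\<in>Basis. (h \<bullet> b) *\<^sub>R b)"
        by (simp add: euclidean_representation)
      also have "\<dots> = (\<Sum>b\<in>Basis. (h \<bullet> b) * frechet_derivative v (at z) b)"
        using has_derivative_linear[OF d] by (simp add: linear_sum linear_scale)
      also have "\<dots> = (\<Sum>b\<in>Basis. (X z \<bullet> b) * (h \<bullet> b))"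
        by (intro sum.cong refl) (simp add: Xb vb_def)
      also have "\<dots> = X z \<bullet> h" by (rule euclidean_inner[symmetric])
      finally show ?thesis .
    qed
    then have "frechet_derivative v (at z) = (\<lambda>h. X z \<bullet> h)" by (rule ext)
    with d show ?thesis by simp
  qed
  \<comment> \<open>\<open>Ck_on 2\<close> supplies differentiability of each partial derivative
    separately; \<open>K\<close> assembles these into the derivative of the vector field
    \<open>X\<close>.\<close>
  define K where "K z h = (\<Sum>b\<in>Basis. frechet_derivative (vb b) (at z) h *\<^sub>R b)" for z h
  have vb': "(vb b has_derivative frechet_derivative (vb b) (at z)) (at z)" if "z \<in> ?H" "b \<in> Basis" for z b
    using dvb[OF that] by (simp add: frechet_derivative_works)
  have X': "(X has_derivative K z) (at z)" if "z \<in> ?H" for z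
  proof -
    have "X = (\<lambda>z. \<Sum>b\<in>Basis. vb b z *\<^sub>R b)" by (simp add: X_def gradient_def vb_def fun_eq_iff)
    then show ?thesis unfolding K_def
      by (auto intro!: has_derivative_sum has_derivative_scaleR_left vb' that)
  qed
  have Kb: "K z h \<bullet> b = frechet_derivative (vb b) (at z) h" if "b \<in> Basis" for z h b
    using that by (simp add: K_def inner_sum_left inner_Basis if_distrib[of "\<lambda>x. _ * x"] cong: if_cong)

  \<comment> \<open>The two differential conditions in Euclidean form\<close>
  define f where "f z = v z - ln (snd z)" for z
  define Y where "Y z = X z - (1 / snd z) *\<^sub>R ?e" for z
  define L where "L z h = K z h + (snd h / (snd z)\<^sup>2) *\<^sub>R ?e" for z h
  have f': "(f has_derivative (\<lambda>h. Y z \<bullet> h)) (at z)" if "z \<in> ?H" for z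
  proof -
    have "((\<lambda>z. ln (snd z)) has_derivative (\<lambda>h. snd h / snd z)) (at z)"
      using y[OF that] by (auto intro!: derivative_eq_intros simp: divide_inverse)
    from has_derivative_diff[OF v'[OF that] this] show ?thesis
      unfolding f_def[abs_def]
      by (rule has_derivative_eq_rhs)
         (simp add: fun_eq_iff Y_def inner_diff_left inner_commute[of ?e] inner_vertical)
  qed
  have Y': "(Y has_derivative L z) (at z)" if "z \<in> ?H" for z
  proof -
    have "((\<lambda>z. (1 / snd z) *\<^sub>R ?e) has_derivative (\<lambda>h. (- snd h / (snd z * snd z)) *\<^sub>R ?e)) (at z)"
      using y[OF that] by (intro has_derivative_scaleR_left) (auto intro!: derivative_eq_intros)
    from has_derivative_diff[OF X'[OF that] this] show ?thesis
      unfolding Y_def[abs_def]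
      by (rule has_derivative_eq_rhs) (simp add: fun_eq_iff L_def power2_eq_square)
  qed
  have expf: "exp (f z) = exp (v z) / snd z" if "z \<in> ?H" for z
    using y[OF that] by (simp add: f_def exp_diff)
  have gs: "g_star v z a b = exp (2 * f z) * (a \<bullet> b)" if "z \<in> ?H" for z a b
  proof -
    have "exp (2 * f z) = (exp (v z) / snd z)\<^sup>2" by (simp add: expf[OF that, symmetric] exp_double)
    then show ?thesis by (simp add: g_star_def exp_double power_divide)
  qed
  have wf: "w_fun v z = 1 - exp (f z)" if "z \<in> ?H" for z
    by (simp add: w_fun_def expf[OF that])
  define \<Delta> where "\<Delta> z = (\<Sum>b\<in>Basis. L z b \<bullet> b)" for z
  \<comment> \<open>The function ln y is itself a solution: y^2 (-1/y^2) - (n - 1) y (1/y) = -n.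
    Subtracting it cancels the constant, so \<open>f\<close> satisfies the homogeneous
    equation.\<close>
  have Delta: "snd z * \<Delta> z = (?n - 1) * (Y z \<bullet> ?e)" if "z \<in> ?H" for z
  proof -
    have 1: "- ((snd z)\<^sup>2 * (\<Sum>b\<in>Basis. K z b \<bullet> b) - (?n - 1) * snd z * (X z \<bullet> ?e)) - ?n = 0"
      using pde that laplace_beltrami_g_plus[OF that v' X'[OF that]] by auto
    have s: "(\<Sum>b\<in>Basis. snd b * (?e \<bullet> b)) = 1"
    proof -
      have "(\<Sum>b\<in>Basis. snd b * (?e \<bullet> b)) = (\<Sum>b\<in>Basis. (?e \<bullet> b) * (?e \<bullet> b))"
        by (simp add: inner_commute[of ?e] inner_vertical)
      also have "\<dots> = ?e \<bullet> ?e" by (rule euclidean_inner[symmetric])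
      finally show ?thesis by simp
    qed
    have "\<Delta> z = (\<Sum>b\<in>Basis. K z b \<bullet> b) + (\<Sum>b\<in>Basis. snd b * (?e \<bullet> b)) / (snd z)\<^sup>2"
      by (simp add: \<Delta>_def L_def inner_add_left sum.distrib sum_divide_distrib del: scaleR_Pair)
    then have "(snd z)\<^sup>2 * \<Delta> z = (snd z)\<^sup>2 * (\<Sum>b\<in>Basis. K z b \<bullet> b) + 1"
      using y[OF that] unfolding s by (simp add: field_simps)
    then have "(snd z)\<^sup>2 * \<Delta> z = (?n - 1) * (snd z * (X z \<bullet> ?e) - 1)" using 1 by (simp add: algebra_simps)
    also have "\<dots> = (?n - 1) * (snd z * (Y z \<bullet> ?e))"
      using y[OF that] by (simp add: Y_def inner_diff_left right_diff_distrib)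
    finally have "snd z * (snd z * \<Delta> z) = snd z * ((?n - 1) * (Y z \<bullet> ?e))"
      by (simp add: power2_eq_square mult_ac)
    then show ?thesis using y[OF that] by simp
  qed
  \<comment> \<open>In dimension n + 1 the factors N - 1 and N - 2 are n and n - 1; the sign flips
    on dividing by - n \<open>exp (- 2 * f z)\<close>.\<close>
  have curv: "2 * \<Delta> z + (?n - 1) * (Y z \<bullet> Y z) \<le> 0" if "z \<in> ?H" for z
  proof -
    have "scalar_curvature (g_star v) z = - exp (- 2 * f z) * (real DIM((real ^ 'n) \<times> real) - 1) *
           (2 * (\<Sum>b\<in>Basis. L z b \<bullet> b) + (real DIM((real ^ 'n) \<times> real) - 2) * (Y z \<bullet> Y z))"
      by (rule scalar_curvature_conformal[OF H that f' Y'[OF that] gs])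
    also have "\<dots> = - (exp (- 2 * f z) * ?n * (2 * \<Delta> z + (?n - 1) * (Y z \<bullet> Y z)))"
      by (simp add: \<Delta>_def)
    finally have "0 \<le> - (exp (- 2 * f z) * ?n * (2 * \<Delta> z + (?n - 1) * (Y z \<bullet> Y z)))"
      using curvature that by metis
    moreover have "0 < exp (- 2 * f z) * ?n" by simp
    ultimately show ?thesis by (simp add: mult_le_0_iff)
  qed
  have "CARD('n) \<noteq> 1" using H10_tilde_not_positive[OF sobolev] positive by blast
  moreover have "0 < CARD('n)" by simp
  ultimately have n2: "2 \<le> ?n" by linarith
  \<comment> \<open>Nonnegative curvature makes \<Delta>f <= 0, and the equation converts this into
    a sign of the vertical derivative because n - 1 > 0.\<close>
  have fy: "Y z \<bullet> ?e \<le> 0" if "z \<in> ?H" for z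
  proof -
    have "0 \<le> Y z \<bullet> Y z" by simp
    then have "0 \<le> (?n - 1) * (Y z \<bullet> Y z)" using n2 by (intro mult_nonneg_nonneg) auto
    then have "\<Delta> z \<le> 0" using curv[OF that] by linarith
    then have "snd z * \<Delta> z \<le> 0" using y[OF that] by (simp add: mult_nonneg_nonpos)
    then show ?thesis using n2 unfolding Delta[OF that] by (simp add: mult_le_0_iff)
  qed

  \<comment> \<open>The sign of \<open>f\<close> from monotonicity and zero boundary values\<close>
  define w where "w = w_fun v"
  have cf: "continuous_on ?H f"
    by (intro continuous_at_imp_continuous_on ballI has_derivative_continuous[OF f'])
  have wc: "continuous_on ?H w"
    by (rule continuous_on_eq[of _ "\<lambda>z. 1 - exp (f z)"]) (auto intro!: continuous_intros cf simp: w_def wf)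
  have fmono: "f (x, s') \<le> f (x, s)" if "0 < s" "s \<le> s'" for x s s'
  proof (rule DERIV_nonpos_imp_nonincreasing[OF that(2)])
    fix t assume "s \<le> t" "t \<le> s'"
    then have t: "(x, t) \<in> ?H" using that by (simp add: half_space_iff)
    have d: "((\<lambda>t. f (x, t)) has_derivative (\<lambda>h. Y (x, t) \<bullet> (0, h))) (at t)"
      by (rule has_derivative_compose[where f="\<lambda>t. (x, t)" and g=f, OF _ f'[OF t]])
         (auto intro!: derivative_eq_intros)
    have eq: "(\<lambda>h. Y (x, t) \<bullet> (0, h)) = (*) (Y (x, t) \<bullet> ?e)"
      by (simp add: inner_prod_def fun_eq_iff)
    have "((\<lambda>t. f (x, t)) has_real_derivative Y (x, t) \<bullet> ?e) (at t)"
      using d unfolding has_field_derivative_def eq .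
    then show "\<exists>D. ((\<lambda>t. f (x, t)) has_real_derivative D) (at t) \<and> D \<le> 0"
      using fy[OF t] by (intro exI conjI)
  qed
  have w0: "0 \<le> w z" if "z \<in> ?H" for z
  proof (rule H10_tilde_nonneg[OF _ wc _ that])
    show "w \<in> H10_tilde" using sobolev by (simp add: w_def)
    fix x s s' assume "0 < (s::real)" "s \<le> s'"
    then show "w (x, s) \<le> w (x, s')"
      using fmono[of s s' x] by (simp add: w_def wf half_space_iff)
  qed
  have f0: "f z \<le> 0" if "z \<in> ?H" for z using w0[OF that] by (simp add: w_def wf that)
  \<comment> \<open>\<Delta> exp (c f) = c exp (c f) (\<Delta>f + c |\<nabla>f|^2), and with this
    \<open>c\<close> the bracket is half of the left-hand side of \<open>curv\<close>. The bound n
    >= 2 makes \<open>c\<close> positive.\<close>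
  define c where "c = (?n - 1) / 2"
  have c: "1 / 2 \<le> c" using n2 by (simp add: c_def)
  define W where "W z = 1 - exp (c * f z)" for z
  define W' where "W' z h = - c * exp (c * f z) * (Y z \<bullet> h)" for z h
  define W'' where "W'' b z h = - c * exp (c * f z) * (L z h \<bullet> b + c * (Y z \<bullet> h) * (Y z \<bullet> b))" for b z h
  have dW: "(W has_derivative W' z) (at z)" if "z \<in> ?H" for z
    unfolding W_def[abs_def] W'_def[abs_def] using f'[OF that]
    by (auto intro!: derivative_eq_intros simp: algebra_simps)
  have ddW: "((\<lambda>z. W' z b) has_derivative W'' b z) (at z)" if "z \<in> ?H" for z b
    unfolding W''_def[abs_def] W'_def using f'[OF that] Y'[OF that]
    by (auto intro!: derivative_eq_intros simp: algebra_simps)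
  have cY: "continuous_on ?H Y"
    by (intro continuous_at_imp_continuous_on ballI has_derivative_continuous[OF Y'])
  have cW'': "continuous_on ?H (\<lambda>z. W'' b z b)" if b: "b \<in> Basis" for b
  proof -
    have cL: "continuous_on ?H (\<lambda>z. L z b \<bullet> b)"
      unfolding L_def inner_add_left Kb[OF b] using y
      by (intro continuous_intros cvb b) force
    show ?thesis unfolding W''_def
      by (rule continuous_on_mult[OF _ continuous_on_add[OF cL]]) (intro continuous_intros cf cY)+
  qed
  have lapW: "0 \<le> (\<Sum>b\<in>Basis. W'' b z b)" if "z \<in> ?H" for z
  proof -
    have "(\<Sum>b\<in>Basis. W'' b z b) = - c * exp (c * f z) * (\<Delta> z + c * (\<Sum>b\<in>Basis. (Y z \<bullet> b) * (Y z \<bullet> b)))"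
      unfolding W''_def \<Delta>_def
      by (simp only: sum_distrib_left sum.distrib[symmetric] mult.assoc)
    also have "(\<Sum>b\<in>Basis. (Y z \<bullet> b) * (Y z \<bullet> b)) = Y z \<bullet> Y z" by (rule euclidean_inner[symmetric])
    finally have eq: "(\<Sum>b\<in>Basis. W'' b z b) = c * exp (c * f z) * - (\<Delta> z + c * (Y z \<bullet> Y z))"
      by (simp only: mult_minus_left mult_minus_right)
    have "\<Delta> z + c * (Y z \<bullet> Y z) \<le> 0" using curv[OF that] by (simp add: c_def field_simps)
    then show ?thesis unfolding eq using c by (intro mult_nonneg_nonneg) auto
  qed
  have incW: "0 \<le> W' z ?e" if "z \<in> ?H" for z
    unfolding W'_def using fy[OF that] c by (simp add: mult_nonneg_nonpos)
  have bdW: "0 \<le> W z \<and> W z \<le> 1" if "z \<in> ?H" for z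
    using f0[OF that] c by (simp add: W_def mult_nonneg_nonpos)
  have cW: "continuous_on ?H W" unfolding W_def by (intro continuous_intros cf)
  \<comment> \<open>The vanishing layer limit is known for \<open>w\<close>, not for
    \<open>W\<close>. As f <= 0 and c <= n, Bernoulli's inequality carries it over: 1 - exp (c f) <=
    1 - exp (n f) <= n (1 - exp f).\<close>
  have Ww: "W z \<le> ?n * w z" if z: "z \<in> ?H" for z
  proof -
    have "1 + ?n * (exp (f z) - 1) \<le> (1 + (exp (f z) - 1)) ^ CARD('n)"
      by (rule Bernoulli_inequality) (use exp_ge_zero[of "f z"] in linarith)
    also have "\<dots> = exp (?n * f z)" by (simp add: exp_of_nat_mult)
    also have "\<dots> \<le> exp (c * f z)"
    proof -
      have "c \<le> ?n" using n2 by (simp add: c_def)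
      then show ?thesis unfolding exp_le_cancel_iff by (rule mult_right_mono_neg[OF _ f0[OF z]])
    qed
    finally show ?thesis by (simp add: W_def w_def wf[OF z] algebra_simps)
  qed

  \<comment> \<open>Zero boundary values of \<open>W\<close> and the conclusion\<close>
  have W0: "W z = 0" if "z \<in> ?H" for z
  proof (rule half_space_subharmonic_eq_0[OF cW _ bdW that])
    fix a :: "(real ^ 'n) \<times> real" and t :: real assume t: "0 < t"
    define \<epsilon> where "\<epsilon> k = inverse (real (Suc k))" for k
    have \<epsilon>: "0 < \<epsilon> k" "\<epsilon> \<longlonglongrightarrow> 0" for k
      unfolding \<epsilon>_def[abs_def] by (simp, rule LIMSEQ_inverse_real_of_nat)
    let ?w = "\<lambda>u k z. indicator ?H z * (u z * (hat (snd z / \<epsilon> k) / \<epsilon> k * (bump a t z)\<^sup>2))"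
    have lay: "(\<lambda>k. integral\<^sup>L lebesgue (?w w k)) \<longlonglongrightarrow> 0" "integrable lebesgue (?w w k)" for k
      using H10_tilde_layer_tendsto_0[OF sobolev[folded w_def] wc less_imp_le[OF t] \<epsilon>] by auto
    have nn: "0 \<le> ?w W k z" and le: "?w W k z \<le> ?n * ?w w k z" for k z
    proof -
      have h: "0 \<le> hat (snd z / \<epsilon> k) / \<epsilon> k * (bump a t z)\<^sup>2" (is "0 \<le> ?h")
        using hat_nonneg \<epsilon>(1)[of k] by simp
      show "0 \<le> ?w W k z"
      proof (cases "z \<in> ?H")
        case True
        with bdW show ?thesis using mult_nonneg_nonneg[OF _ h, of "W z"] by simp
      qed simp
      show "?w W k z \<le> ?n * ?w w k z"
      proof (cases "z \<in> ?H")
        case True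
        then show ?thesis using mult_right_mono[OF Ww[OF True] h] by (simp add: mult.assoc)
      qed simp
    qed
    have abs_le: "\<bar>?w W k z\<bar> \<le> \<bar>?n * ?w w k z\<bar>" for k z
      unfolding abs_of_nonneg[OF nn] using le abs_ge_self by (rule order_trans)
    have layW_int: "integrable lebesgue (?w W k)" for k
    proof (rule Bochner_Integration.integrable_bound[OF integrable_mult_right[OF lay(2)]])
      have "(\<lambda>z. indicator ?H z *\<^sub>R (W z * (hat (snd z / \<epsilon> k) / \<epsilon> k * (bump a t z)\<^sup>2))) \<in> borel_measurable borel"
        using \<epsilon>(1)[of k]
        by (intro borel_measurable_continuous_on_indicator borel_open H continuous_intros
            cW continuous_on_hat continuous_on_bump) auto
      then show "?w W k \<in> borel_measurable lebesgue" by (simp add: measurable_completion)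
      show "AE z in lebesgue. norm (?w W k z) \<le> norm (?n * ?w w k z)"
        using abs_le by (intro AE_I2) (simp only: real_norm_def)
    qed
    \<comment> \<open>Squeezed between 0 and n times the layer integral of \<open>w\<close>, using
      that \<open>W\<close> is nonnegative.\<close>
    have "(\<lambda>k. integral\<^sup>L lebesgue (?w W k)) \<longlonglongrightarrow> 0"
    proof (rule tendsto_sandwich[of "\<lambda>_. 0" _ _ "\<lambda>k. ?n * integral\<^sup>L lebesgue (?w w k)"])
      show "\<forall>\<^sub>F k in sequentially. 0 \<le> integral\<^sup>L lebesgue (?w W k)"
        by (intro always_eventually allI integral_nonneg_AE AE_I2 nn)
      have "integral\<^sup>L lebesgue (?w W k) \<le> integral\<^sup>L lebesgue (\<lambda>z. ?n * ?w w k z)" for k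
        by (rule integral_mono[OF layW_int integrable_mult_right[OF lay(2)] le])
      then show "\<forall>\<^sub>F k in sequentially. integral\<^sup>L lebesgue (?w W k) \<le> ?n * integral\<^sup>L lebesgue (?w w k)"
        by (simp only: integral_mult_right_zero always_eventually simp_thms)
      show "(\<lambda>k. ?n * integral\<^sup>L lebesgue (?w w k)) \<longlonglongrightarrow> 0"
        using tendsto_mult_left[OF lay(1), of ?n] by simp
    qed simp
    then show "0 \<le> integral\<^sup>L lebesgue (\<lambda>z. indicator half_space z * W z *
      (24 * bump a t z * (norm (z - a))\<^sup>2 - 6 * real (DIM((real ^ 'n) \<times> real)) * (bump a t z)\<^sup>2))"
      by (intro subharmonic_bump3_nonneg[OF dW ddW cW'' lapW incW bdW \<epsilon> less_imp_le[OF t] _ layW_int])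
  qed
  \<comment> \<open>\<open>W z = 0\<close> means \<open>c * f z = 0\<close>, and \<open>c\<close> is
    not 0; both claims then follow from exp 0 = 1.\<close>
  have f_0: "f z = 0" if "z \<in> ?H" for z
    using W0[OF that] c by (auto simp: W_def)
  show ?thesis using f_0 by (auto simp: wf gs)
qed

end
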